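(* Consider the distributed online problem and the distributed online primal--dual composite mirror descent algorithm described in the context. Suppose that: (1) $\mathbb{X}\subseteq\mathbb{R}^p$ is closed and convex, and for all $i\in[n]$, $t\in\mathbb{N}_+$ the functions $r_t$, $f_{i,t}$, $g_{i,t}$ are convex ($g_{i,t}$ componentwise). (2) There is a constant $F>0$ with $|l_{i,t}(x)-l_{i,t}(y)|\le F$ for all $i\in[n]$, $t\in\mathbb{N}_+$, $x,y\in\mathbb{X}$. (3) For all $i\in[n]$, $t\in\mathbb{N}_+$, $x\in\mathbb{X}$ the subgradients $\nabla r_t(x),\nabla f_{i,t}(x),\nabla g_{i,t}(x)$ exist, and there are constants $G_1,G_2>0$ with $\|\nabla l_{i,t}(x)\|\le G_1$ and $\|\nabla g_{i,t}(x)\|\le G_2$ for all such $i,t,x$. (4) For every $t\in\mathbb{N}_+$: (a) there is a constant $w\in(0,1)$ (independent of $t$) such that $[W_t]_{ij}\ge w$ whenever $[W_t]_{ij}>0$; (b) $W_t$ is doubly stochastic; (c) there is an integer $B>0$ (independent of $t$) such that the directed graph $(\mathcal{V},\cup_{l=0}^{B-1}\mathcal{E}_{t+l})$ is strongly connected. (5) For every $x\in\mathbb{X}$ the function $\mathcal{D}_\psi(x,\cdot):\mathbb{X}\to\mathbb{R}$ is convex. (6) There is a constant $\mu>0$ such that for all $i\in[n]$, $t\in\mathbb{N}_+$ and $x,y\in\mathbb{X}$, $f_{i,t}(x)\ge f_{i,t}(y)+\langle x-y,\nabla f_{i,t}(y)\rangle+\mu\mathcal{D}_\psi(x,y)$.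 Let $\{x_{i,t}\}$, $i\in[n]$, be the sequences generated by the algorithm with $$\alpha_t=\frac{1}{\mu t},\qquad \gamma_t=\frac{\gamma_0}{\alpha_t},\qquad \forall t\in\mathbb{N}_+,$$ where $\gamma_0\in(0,\sigma/(4G_2^2)]$ is a constant. Then, for any $T\in\mathbb{N}_+$, $$\mathrm{Net\text{-}Reg}(T)=\mathcal{O}(\log(T)),\qquad \frac{1}{n}\sum_{i=1}^n\sum_{t=1}^T\|[g_{t}(x_{i,t})]_+\|=\mathcal{O}(\sqrt{\log(T)T}).$$ Moreover, if in addition Slater's condition holds, i.e. there exist $x_s\in\mathbb{X}$ and $\epsilon_s>0$ such that $g_t(x_s)\le-\epsilon_s\mathbf{1}_m$ for all $t\in\mathbb{N}_+$, then $$\frac{1}{n}\sum_{i=1}^n\sum_{t=1}^T\|[g_{t}(x_{i,t})]_+\|=\mathcal{O}(\log(T)).$$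
   Context: Notation. $[n]=\{1,\dots,n\}$; $\|\cdot\|$ is the Euclidean norm for vectors and the induced 2-norm for matrices; $[x]_+$ is the componentwise positive part (projection onto the nonnegative orthant); vector inequalities are componentwise; $\mathbf{1}_m$ and $\mathbf{0}_m$ are the all-ones and zero vectors of $\mathbb{R}^m$; $\nabla f(x)$ denotes a (sub)gradient of $f$ at $x$. For $g_{i,t}:\mathbb{R}^p\to\mathbb{R}^{m_i}$, $\nabla g_{i,t}(x)\in\mathbb{R}^{m_i\times p}$ is the matrix whose rows are subgradients of the components, so $g_{i,t}(y)\ge g_{i,t}(x)+\nabla g_{i,t}(x)(y-x)$. Bounds on subgradients hold for all subgradients, and $\nabla l_{i,t}(x)=\nabla f_{i,t}(x)+\nabla r_t(x)$. Problem. There are $n$ agents and a known set $\mathbb{X}\subseteq\mathbb{R}^p$. For each $i\in[n]$ and round $t\in\mathbb{N}_+$ there are a local loss $l_{i,t}=f_{i,t}+r_t:\mathbb{R}^p\to\mathbb{R}$ ($r_t$ common to all agents) and a local constraint function $g_{i,t}:\mathbb{R}^p\to\mathbb{R}^{m_i}$; these may vary arbitrarily with $t$. Set $l_t(x)=\frac1n\sum_{i=1}^n l_{i,t}(x)$, $g_t(x)=\mathrm{col}(g_{1,t}(x),\dots,g_{n,t}(x))\in\mathbb{R}^m$ (stacked column vector), $m=\sum_i m_i$, and $$\mathcal{X}_T=\{x\in\mathbb{X}: g_t(x)\le \mathbf{0}_m,\ \forall t\in[T]\},$$ which is assumed nonempty for every $T$. Network regret is $$\mathrm{Net\text{-}Reg}(T)=\frac1n\sum_{i=1}^n\Big(\sum_{t=1}^T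 l_t(x_{i,t})-\min_{x\in\mathcal{X}_T}\sum_{t=1}^T l_t(x)\Big),$$ and network cumulative constraint violation is $\frac1n\sum_{i=1}^n\sum_{t=1}^T\|[g_t(x_{i,t})]_+\|$. Communication. At round $t$ the directed graph is $\mathcal{G}_t=(\mathcal{V},\mathcal{E}_t)$, $\mathcal{V}=[n]$, with mixing matrix $W_t\in\mathbb{R}^{n\times n}$ satisfying $[W_t]_{ij}>0$ if $(j,i)\in\mathcal{E}_t$ or $i=j$, and $[W_t]_{ij}=0$ otherwise. Bregman divergence. $\psi:\mathbb{R}^p\to\mathbb{R}$ is differentiable and strongly convex on $\mathbb{X}$ with parameter $\sigma>0$, i.e. $\psi(x)\ge\psi(y)+\langle\nabla\psi(y),x-y\rangle+\frac{\sigma}{2}\|x-y\|^2$ for $x,y\in\mathbb{X}$; $\mathcal{D}_\psi(x,y)=\psi(x)-\psi(y)-\langle\nabla\psi(y),x-y\rangle$. Algorithm. Input: a nonincreasing sequence $\{\alpha_t>0\}$ and a nondecreasing sequence $\{\gamma_t>0\}$. Initialize any $z_{i,1}\in\mathbb{X}$, $i\in[n]$. For $t=1,2,\dots$ and each $i\in[n]$: $$x_{i,t}=\sum_{j=1}^n[W_t]_{ij}z_{j,t},\qquad q_{i,t+1}=\gamma_t[g_{i,t}(x_{i,t})]_+,\qquad \omega_{i,t+1}=\nabla f_{i,t}(x_{i,t})+(\nabla g_{i,t}(x_{i,t}))^\top q_{i,t+1},$$ $$z_{i,t+1}=\arg\min_{x\in\mathbb{X}}\{\alpha_t\langle x,\omega_{i,t+1}\rangle+\alpha_t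 r_t(x)+\mathcal{D}_\psi(x,x_{i,t})\}.$$ Order notation. A quantity indexed by $T$ is $\mathcal{O}(b_T)$ if it is at most $C\,b_T$ for all $T\ge 2$, with a constant $C>0$ independent of $T$ (depending only on the problem constants, the algorithm constants and the initial points). *)

theory Defs
  imports "HOL-Analysis.Analysis"
begin

text \<open>
  Agents are the elements of a finite type \<open>'n\<close>, and rounds are the natural numbers \<open>t \<ge> 1\<close>;
  values at \<open>t = 0\<close> are never used.  The dimension \<open>m i\<close> of the constraint function of agent \<open>i\<close>
  depends on \<open>i\<close>, so a vector of dimension \<open>d\<close> is a function on \<open>nat\<close> of which only the values
  below \<open>d\<close> matter, and its Euclidean norm is \<open>L2_set _ {..<d}\<close>.
\<close>

definition subgradient :: "('a::real_inner \<Rightarrow> real) \<Rightarrow> 'a \<Rightarrow> 'a \<Rightarrow> bool" where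
  "subgradient h x s \<longleftrightarrow> (\<forall>y. h y \<ge> h x + s \<bullet> (y - x))"

text \<open>Induced 2-norm of the \<open>d\<close>-row matrix with rows \<open>A 0, \<dots>, A (d - 1)\<close>; compare \<^const>\<open>onorm\<close>,
  which does not apply because the codomain is not a normed type.  The vector \<open>v = 0\<close>
  contributes \<open>0 / 0 = 0\<close>.\<close>

definition induced_norm :: "nat \<Rightarrow> (nat \<Rightarrow> 'a::real_inner) \<Rightarrow> real" where
  "induced_norm d A = (SUP v. L2_set (\<lambda>k. A k \<bullet> v) {..<d} / norm v)"

definition pos_part :: "real \<Rightarrow> real" where
  "pos_part a = max 0 a"

definition bregman :: "('a::real_inner \<Rightarrow> real) \<Rightarrow> ('a \<Rightarrow> 'a) \<Rightarrow> 'a \<Rightarrow> 'a \<Rightarrow> real" where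
  "bregman \<psi> d\<psi> x y = \<psi> x - \<psi> y - d\<psi> y \<bullet> (x - y)"

definition strongly_connected :: "('n \<times> 'n) set \<Rightarrow> bool" where
  "strongly_connected E \<longleftrightarrow> (\<forall>i j. (i, j) \<in> E\<^sup>*)"

definition avg_loss :: "('n::finite \<Rightarrow> nat \<Rightarrow> 'a \<Rightarrow> real) \<Rightarrow> nat \<Rightarrow> 'a \<Rightarrow> real" where
  "avg_loss l t x = (\<Sum>i\<in>UNIV. l i t x) / real CARD('n)"

definition feasible_set ::
  "'a set \<Rightarrow> ('n \<Rightarrow> nat) \<Rightarrow> ('n \<Rightarrow> nat \<Rightarrow> 'a \<Rightarrow> nat \<Rightarrow> real) \<Rightarrow> nat \<Rightarrow> 'a set" where
  "feasible_set X m g T = {x \<in> X. \<forall>t\<in>{1..T}. \<forall>i. \<forall>k<m i. g i t x k \<le> 0}"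

text \<open>\<open>LEAST v. v \<in> S\<close> is the minimum of \<open>S\<close>, which may be infinite; nothing is assumed about its
  existence, so attainment of the minimum is part of any bound on the regret.\<close>

definition net_regret ::
  "'a set \<Rightarrow> ('n::finite \<Rightarrow> nat) \<Rightarrow> ('n \<Rightarrow> nat \<Rightarrow> 'a \<Rightarrow> real) \<Rightarrow>
   ('n \<Rightarrow> nat \<Rightarrow> 'a \<Rightarrow> nat \<Rightarrow> real) \<Rightarrow> ('n \<Rightarrow> nat \<Rightarrow> 'a) \<Rightarrow> nat \<Rightarrow> real" where
  "net_regret X m l g x T =
     (\<Sum>i\<in>UNIV. (\<Sum>t=1..T. avg_loss l t (x i t))
        - (LEAST v. v \<in> (\<lambda>y. \<Sum>t=1..T. avg_loss l t y) ` feasible_set X m g T)) / real CARD('n)"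

text \<open>The stacked vector \<open>g\<^sub>t(y)\<close> is indexed by the pairs \<open>(i, k)\<close> with \<open>k < m i\<close>.\<close>

definition net_violation ::
  "('n::finite \<Rightarrow> nat) \<Rightarrow> ('n \<Rightarrow> nat \<Rightarrow> 'a \<Rightarrow> nat \<Rightarrow> real) \<Rightarrow> ('n \<Rightarrow> nat \<Rightarrow> 'a) \<Rightarrow> nat \<Rightarrow> real" where
  "net_violation m g x T =
     (\<Sum>i\<in>UNIV. \<Sum>t=1..T.
        L2_set (\<lambda>(j, k). pos_part (g j t (x i t) k)) (SIGMA j:UNIV. {..<m j})) / real CARD('n)"

definition slater ::
  "('n \<Rightarrow> nat) \<Rightarrow> ('n \<Rightarrow> nat \<Rightarrow> 'a \<Rightarrow> nat \<Rightarrow> real) \<Rightarrow> 'a \<Rightarrow> real \<Rightarrow> bool" where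
  "slater m g xs \<epsilon> \<longleftrightarrow> (\<forall>t\<ge>1. \<forall>i. \<forall>k<m i. g i t xs k \<le> - \<epsilon>)"

text \<open>\<open>df i t x\<close> and the rows \<open>dg i t x k\<close> are the subgradients used by the algorithm; the norm
  bounds are imposed on all subgradients.\<close>

locale online_problem =
  fixes X :: "(real ^ 'p) set"
    and m :: "'n::finite \<Rightarrow> nat"
    and f :: "'n \<Rightarrow> nat \<Rightarrow> real ^ 'p \<Rightarrow> real"
    and r :: "nat \<Rightarrow> real ^ 'p \<Rightarrow> real"
    and g :: "'n \<Rightarrow> nat \<Rightarrow> real ^ 'p \<Rightarrow> nat \<Rightarrow> real"
    and df :: "'n \<Rightarrow> nat \<Rightarrow> real ^ 'p \<Rightarrow> real ^ 'p"
    and dg :: "'n \<Rightarrow> nat \<Rightarrow> real ^ 'p \<Rightarrow> nat \<Rightarrow> real ^ 'p"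
    and F G1 G2 :: real
  assumes closed_X: "closed X" and convex_X: "convex X"
    and feasible: "\<And>T. T \<ge> 1 \<Longrightarrow> feasible_set X m g T \<noteq> {}"
    and convex_r: "\<And>t. t \<ge> 1 \<Longrightarrow> convex_on UNIV (r t)"
    and convex_f: "\<And>i t. t \<ge> 1 \<Longrightarrow> convex_on UNIV (f i t)"
    and convex_g: "\<And>i t k. t \<ge> 1 \<Longrightarrow> k < m i \<Longrightarrow> convex_on UNIV (\<lambda>x. g i t x k)"
    and loss_variation: "\<And>i t x y. t \<ge> 1 \<Longrightarrow> x \<in> X \<Longrightarrow> y \<in> X \<Longrightarrow>
          \<bar>(f i t x + r t x) - (f i t y + r t y)\<bar> \<le> F"
    and subgradient_r: "\<And>t x. t \<ge> 1 \<Longrightarrow> x \<in> X \<Longrightarrow> \<exists>s. subgradient (r t) x s"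
    and subgradient_f: "\<And>i t x. t \<ge> 1 \<Longrightarrow> x \<in> X \<Longrightarrow> subgradient (f i t) x (df i t x)"
    and subgradient_g: "\<And>i t x k. t \<ge> 1 \<Longrightarrow> x \<in> X \<Longrightarrow> k < m i \<Longrightarrow>
          subgradient (\<lambda>y. g i t y k) x (dg i t x k)"
    and bound_l: "\<And>i t x a b. t \<ge> 1 \<Longrightarrow> x \<in> X \<Longrightarrow>
          subgradient (f i t) x a \<Longrightarrow> subgradient (r t) x b \<Longrightarrow> norm (a + b) \<le> G1"
    and bound_g: "\<And>i t x A. t \<ge> 1 \<Longrightarrow> x \<in> X \<Longrightarrow>
          (\<forall>k<m i. subgradient (\<lambda>y. g i t y k) x (A k)) \<Longrightarrow> induced_norm (m i) A \<le> G2"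

text \<open>An edge \<open>(j, i) \<in> E t\<close> means that \<open>i\<close> receives from \<open>j\<close> at round \<open>t\<close>.\<close>

locale mixing_network =
  fixes E :: "nat \<Rightarrow> ('n::finite \<times> 'n) set"
    and W :: "nat \<Rightarrow> real ^ 'n ^ 'n"
    and w :: real
    and B :: nat
  assumes weight_pos: "\<And>t i j. t \<ge> 1 \<Longrightarrow> (j, i) \<in> E t \<or> i = j \<Longrightarrow> W t $ i $ j > 0"
    and weight_zero: "\<And>t i j. t \<ge> 1 \<Longrightarrow> \<not> ((j, i) \<in> E t \<or> i = j) \<Longrightarrow> W t $ i $ j = 0"
    and weight_lower: "\<And>t i j. t \<ge> 1 \<Longrightarrow> W t $ i $ j > 0 \<Longrightarrow> W t $ i $ j \<ge> w"
    and row_sum: "\<And>t i. t \<ge> 1 \<Longrightarrow> (\<Sum>j\<in>UNIV. W t $ i $ j) = 1"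
    and column_sum: "\<And>t j. t \<ge> 1 \<Longrightarrow> (\<Sum>i\<in>UNIV. W t $ i $ j) = 1"
    and jointly_connected: "\<And>t. t \<ge> 1 \<Longrightarrow> strongly_connected (\<Union>l\<in>{0..B - 1}. E (t + l))"

locale mirror_map =
  fixes X :: "(real ^ 'p) set"
    and \<psi> :: "real ^ 'p \<Rightarrow> real"
    and d\<psi> :: "real ^ 'p \<Rightarrow> real ^ 'p"
    and \<sigma> :: real
  assumes gradient: "\<And>x. x \<in> X \<Longrightarrow> GDERIV \<psi> x :> d\<psi> x"
    and strong_convexity: "\<And>x y. x \<in> X \<Longrightarrow> y \<in> X \<Longrightarrow>
          \<psi> x \<ge> \<psi> y + d\<psi> y \<bullet> (x - y) + \<sigma> / 2 * (norm (x - y))\<^sup>2"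
    and bregman_convex: "\<And>x. x \<in> X \<Longrightarrow> convex_on X (\<lambda>y. bregman \<psi> d\<psi> x y)"

text \<open>The sum in the equation for \<open>\<omega>\<close> is the transposed Jacobian, given by its rows, applied to \<open>q\<close>.\<close>

definition mirror_descent_run ::
  "(real ^ 'p) set \<Rightarrow> (real ^ 'p \<Rightarrow> real) \<Rightarrow> (real ^ 'p \<Rightarrow> real ^ 'p) \<Rightarrow> ('n::finite \<Rightarrow> nat) \<Rightarrow>
   (nat \<Rightarrow> real ^ 'p \<Rightarrow> real) \<Rightarrow> ('n \<Rightarrow> nat \<Rightarrow> real ^ 'p \<Rightarrow> nat \<Rightarrow> real) \<Rightarrow>
   ('n \<Rightarrow> nat \<Rightarrow> real ^ 'p \<Rightarrow> real ^ 'p) \<Rightarrow> ('n \<Rightarrow> nat \<Rightarrow> real ^ 'p \<Rightarrow> nat \<Rightarrow> real ^ 'p) \<Rightarrow>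
   (nat \<Rightarrow> real ^ 'n ^ 'n) \<Rightarrow> (nat \<Rightarrow> real) \<Rightarrow> (nat \<Rightarrow> real) \<Rightarrow> ('n \<Rightarrow> real ^ 'p) \<Rightarrow>
   ('n \<Rightarrow> nat \<Rightarrow> real ^ 'p) \<Rightarrow> ('n \<Rightarrow> nat \<Rightarrow> real ^ 'p) \<Rightarrow>
   ('n \<Rightarrow> nat \<Rightarrow> nat \<Rightarrow> real) \<Rightarrow> ('n \<Rightarrow> nat \<Rightarrow> real ^ 'p) \<Rightarrow> bool" where
  "mirror_descent_run X \<psi> d\<psi> m r g df dg W \<alpha> \<gamma> z1 x z q \<omega> \<longleftrightarrow>
     (\<forall>i. z1 i \<in> X \<and> z i 1 = z1 i) \<and>
     (\<forall>t\<ge>1. \<forall>i.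
        x i t = (\<Sum>j\<in>UNIV. W t $ i $ j *\<^sub>R z j t) \<and>
        (\<forall>k<m i. q i (t + 1) k = \<gamma> t * pos_part (g i t (x i t) k)) \<and>
        \<omega> i (t + 1) = df i t (x i t) + (\<Sum>k<m i. q i (t + 1) k *\<^sub>R dg i t (x i t) k) \<and>
        is_arg_min
          (\<lambda>y. \<alpha> t * (y \<bullet> \<omega> i (t + 1)) + \<alpha> t * r t y + bregman \<psi> d\<psi> y (x i t))
          (\<lambda>y. y \<in> X) (z i (t + 1)))"

end

theory Submission
  imports Defs
begin

text \<open>
  Testing the optimality condition of the mirror step against a comparator \<open>y\<close> and averaging with
  the doubly stochastic weights, the divergences enter with the coefficients \<open>\<mu> (t - 1)\<close> and
  \<open>- \<mu> t\<close>, so they telescope.  Since \<open>\<alpha> t * \<gamma> t = \<gamma>0\<close> is small, a quarter of the penalty term absorbs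
  the effect of the constraint gradients on the step, and one obtains
  \<open>(\<Sum>t. \<Sum>i. loss i t (x i t) - loss i t y) + \<kappa> (\<Sum>t. t (\<Sum>i. (v i t)^2)) \<le> c (\<Sum>t. 1 / t)\<close>
  for feasible \<open>y\<close>, where \<open>v i t\<close> is the norm of the violation of agent \<open>i\<close>'s own constraint.
  The displacement \<open>z i (t + 1) - x i t\<close> is \<open>O(1 / t + v i t)\<close>, and products of enough consecutive
  mixing matrices contract the diameter of the iterates, so the total disagreement is
  \<open>O(ln T + (\<Sum>t. \<Sum>i. v i t))\<close>.  The quadratic term pays for the disagreement in the regret, and with
  Cauchy-Schwarz it gives the first bound on the violation.  Under Slater's condition the comparator
  \<open>xs\<close> contributes an extra term \<open>\<epsilon> t (\<Sum>i. v i t)\<close>, hence \<open>(\<Sum>t\<le>T. t (\<Sum>i. v i t)) = O(T)\<close> for all \<open>T\<close>,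
  and summation by parts turns this into \<open>O(ln T)\<close>.
\<close>

subsection \<open>Consensus\<close>

text \<open>The newest factor stands on the left, so row \<open>i\<close> holds the weights with
  which agent \<open>i\<close> at round \<open>t + k\<close> combines the values of round
  \<open>t\<close>.\<close>

primrec transition :: "(nat \<Rightarrow> real ^ 'n ^ 'n) \<Rightarrow> nat \<Rightarrow> nat \<Rightarrow> real ^ 'n ^ 'n" where
  "transition W t 0 = mat 1"
| "transition W t (Suc k) = W (t + k) ** transition W t k"

lemma transition_Suc_nth:
  "transition W t (Suc k) $ i $ j = (\<Sum>l\<in>UNIV. W (t + k) $ i $ l * transition W t k $ l $ j)"
  by (simp add: matrix_matrix_mult_def)

text \<open>A path from \<open>a\<close> inside \<open>R\<close> to \<open>b\<close> outside must
  cross the boundary of \<open>R\<close> along some edge. This edge is what enlarges the set of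
  informed agents below.\<close>

lemma strongly_connected_leaves:
  assumes "strongly_connected E" "a \<in> R" "b \<notin> R"
  obtains u v where "(u, v) \<in> E" "u \<in> R" "v \<notin> R"
proof -
  have "(a, b) \<in> E\<^sup>*"
    using assms(1) by (simp add: strongly_connected_def)
  then have "b \<notin> R \<longrightarrow> (\<exists>u v. (u, v) \<in> E \<and> u \<in> R \<and> v \<notin> R)"
    by (induction rule: rtrancl_induct) (use assms(2) in blast)+
  with assms(3) that show ?thesis
    by blast
qed

text \<open>Dobrushin's contraction: both rows share the mass \<open>\<delta>\<close> in every column, so only the
  remaining mass \<open>1 - n\<delta>\<close> separates the two averages.\<close>

lemma dobrushin_contraction:
  fixes \<delta> D :: real and p q :: "'n::finite \<Rightarrow> real" and v :: "'n \<Rightarrow> 'a::real_normed_vector"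
  assumes p: "sum p UNIV = 1" "\<And>k. p k \<ge> \<delta>"
    and q: "sum q UNIV = 1" "\<And>k. q k \<ge> \<delta>"
    and v: "\<And>k l. norm (v k - v l) \<le> D"
  shows "norm ((\<Sum>k\<in>UNIV. p k *\<^sub>R v k) - (\<Sum>k\<in>UNIV. q k *\<^sub>R v k)) \<le> (1 - CARD('n) * \<delta>) * D"
proof -
  define c where "c = 1 - CARD('n) * \<delta>"
  have sp: "(\<Sum>k\<in>UNIV. p k - \<delta>) = c" and sq: "(\<Sum>k\<in>UNIV. q k - \<delta>) = c"
    using p(1) q(1) by (simp_all add: sum_subtractf c_def)
  have c0: "c \<ge> 0"
    using p(2) sp[symmetric] by (simp add: sum_nonneg)
  \<comment> \<open>Scaling by \<open>c\<close> writes both averages over the product of the two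
    residual weights, each of total mass \<open>c\<close>; the difference is then a weighted sum of
    the \<open>v k - v l\<close>.\<close>
  have "c *\<^sub>R ((\<Sum>k\<in>UNIV. p k *\<^sub>R v k) - (\<Sum>k\<in>UNIV. q k *\<^sub>R v k))
      = c *\<^sub>R (\<Sum>k\<in>UNIV. (p k - \<delta>) *\<^sub>R v k) - c *\<^sub>R (\<Sum>l\<in>UNIV. (q l - \<delta>) *\<^sub>R v l)"
    by (simp add: algebra_simps sum_subtractf)
  also have "\<dots> = (\<Sum>l\<in>UNIV. q l - \<delta>) *\<^sub>R (\<Sum>k\<in>UNIV. (p k - \<delta>) *\<^sub>R v k)
      - (\<Sum>k\<in>UNIV. p k - \<delta>) *\<^sub>R (\<Sum>l\<in>UNIV. (q l - \<delta>) *\<^sub>R v l)"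
    by (simp only: sp sq)
  also have "(\<Sum>l\<in>UNIV. q l - \<delta>) *\<^sub>R (\<Sum>k\<in>UNIV. (p k - \<delta>) *\<^sub>R v k)
      = (\<Sum>k\<in>UNIV. \<Sum>l\<in>UNIV. ((p k - \<delta>) * (q l - \<delta>)) *\<^sub>R v k)"
    by (simp only: scaleR_sum_left scaleR_sum_right scaleR_scaleR sum_distrib_left sum_distrib_right mult.commute)
  also have "(\<Sum>k\<in>UNIV. p k - \<delta>) *\<^sub>R (\<Sum>l\<in>UNIV. (q l - \<delta>) *\<^sub>R v l)
      = (\<Sum>k\<in>UNIV. \<Sum>l\<in>UNIV. ((p k - \<delta>) * (q l - \<delta>)) *\<^sub>R v l)"
    by (subst sum.swap)
      (simp only: scaleR_sum_left scaleR_sum_right scaleR_scaleR sum_distrib_left sum_distrib_right mult.commute)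
  also have "(\<Sum>k\<in>UNIV. \<Sum>l\<in>UNIV. ((p k - \<delta>) * (q l - \<delta>)) *\<^sub>R v k) - \<dots>
      = (\<Sum>k\<in>UNIV. \<Sum>l\<in>UNIV. ((p k - \<delta>) * (q l - \<delta>)) *\<^sub>R (v k - v l))"
    by (simp add: sum_subtractf scaleR_right_diff_distrib)
  also have "norm \<dots> \<le> (\<Sum>k\<in>UNIV. \<Sum>l\<in>UNIV. ((p k - \<delta>) * (q l - \<delta>)) * D)"
    using p(2) q(2) v
    by (intro sum_norm_le) (simp add: abs_mult mult_left_mono)
  also have "\<dots> = c * (c * D)"
  proof -
    have "(\<Sum>k\<in>UNIV. \<Sum>l\<in>UNIV. ((p k - \<delta>) * (q l - \<delta>)) * D)
        = (\<Sum>k\<in>UNIV. p k - \<delta>) * ((\<Sum>l\<in>UNIV. q l - \<delta>) * D)"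
      by (simp only: sum_distrib_left sum_distrib_right mult.assoc) (rule sum.swap)
    then show ?thesis
      by (simp only: sp sq)
  qed
  finally have main: "c * norm ((\<Sum>k\<in>UNIV. p k *\<^sub>R v k) - (\<Sum>k\<in>UNIV. q k *\<^sub>R v k)) \<le> c * (c * D)"
    using c0 by simp
  \<comment> \<open>\<open>main\<close> carries a factor \<open>c\<close>, which cancels unless it
    is zero. In that case both weight vectors are constantly \<delta> and the averages
    coincide.\<close>
  show ?thesis
  proof (cases "c = 0")
    case True
    then have "p k - \<delta> = 0" "q k - \<delta> = 0" for k
      using sp sq p(2) q(2) sum_nonneg_eq_0_iff[of UNIV "\<lambda>k. p k - \<delta>"]
        sum_nonneg_eq_0_iff[of UNIV "\<lambda>k. q k - \<delta>"] by auto
    then have "p = q"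
      by (auto simp: fun_eq_iff)
    with True show ?thesis
      by (simp add: c_def)
  next
    case False
    with main c0 show ?thesis
      by (simp add: c_def)
  qed
qed

section \<open>Products of mixing matrices and perturbed averaging\<close>

context mixing_network
begin

lemma weight_nonneg: "t \<ge> 1 \<Longrightarrow> W t $ i $ j \<ge> 0"
  using weight_pos[of t j i] weight_zero[of t j i] by fastforce

lemma transition_nonneg: "t \<ge> 1 \<Longrightarrow> transition W t k $ i $ j \<ge> 0"
  by (induction k arbitrary: i)
    (simp_all add: mat_def transition_Suc_nth sum_nonneg weight_nonneg del: transition.simps(2))

lemma transition_row_sum: "t \<ge> 1 \<Longrightarrow> (\<Sum>j\<in>UNIV. transition W t k $ i $ j) = 1"
proof (induction k arbitrary: i)
  case 0
  then show ?case
    by (simp add: mat_def)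
next
  case (Suc k)
  have "(\<Sum>j\<in>UNIV. transition W t (Suc k) $ i $ j)
      = (\<Sum>l\<in>UNIV. W (t + k) $ i $ l * (\<Sum>j\<in>UNIV. transition W t k $ l $ j))"
    unfolding transition_Suc_nth sum_distrib_left by (rule sum.swap)
  with Suc show ?case
    by (simp add: row_sum)
qed

lemma transition_step:
  assumes "t \<ge> 1"
  shows "W (t + k) $ i $ l * transition W t k $ l $ j \<le> transition W t (Suc k) $ i $ j"
  unfolding transition_Suc_nth
  using assms by (intro member_le_sum) (auto simp: weight_nonneg transition_nonneg)

text \<open>A positive entry contains a product of \<open>k\<close> positive weights along some
  walk, and each of these weights is at least \<open>w\<close>.\<close>

lemma transition_lower:
  assumes "t \<ge> 1" "transition W t k $ i $ j > 0" "w > 0"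
  shows "transition W t k $ i $ j \<ge> w ^ k"
  using assms(2)
proof (induction k arbitrary: i)
  case 0
  then show ?case
    by (auto simp: mat_def split: if_splits)
next
  case (Suc k)
  obtain l where "W (t + k) $ i $ l * transition W t k $ l $ j > 0"
    using Suc.prems unfolding transition_Suc_nth
    by (meson not_less sum_nonpos)
  then have l: "W (t + k) $ i $ l > 0" "transition W t k $ l $ j > 0"
    using weight_nonneg[of "t + k" i l] transition_nonneg[of t k l j] assms(1)
    by (auto simp: zero_less_mult_iff)
  have "w ^ Suc k \<le> W (t + k) $ i $ l * transition W t k $ l $ j"
    using l weight_lower[of "t + k" i l] Suc.IH[of l] assms by (simp add: mult_mono)
  also note transition_step[OF assms(1)]
  finally show ?case .
qed

text \<open>The agents whose value at round \<open>t + k\<close> is influenced by the value of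
  \<open>j\<close> at round \<open>t\<close>.\<close>

definition reached :: "nat \<Rightarrow> 'n \<Rightarrow> nat \<Rightarrow> 'n set" where
  "reached t j k = {i. transition W t k $ i $ j > 0}"

lemma reached_step:
  assumes "t \<ge> 1" "a \<in> reached t j k" "a = b \<or> (a, b) \<in> E (t + k)"
  shows "b \<in> reached t j (Suc k)"
proof -
  have "0 < W (t + k) $ b $ a * transition W t k $ a $ j"
    using assms weight_pos[of "t + k" a b] by (auto simp: reached_def)
  also note transition_step[OF assms(1)]
  finally show ?thesis
    by (simp add: reached_def del: transition.simps)
qed

text \<open>Every agent puts positive weight on itself, so influence is never lost.\<close>

lemma reached_mono:
  assumes "t \<ge> 1" "k \<le> k'"
  shows "reached t j k \<subseteq> reached t j k'"
  using assms(2) by (induction rule: dec_induct) (use reached_step[OF assms(1)] in blast)+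

text \<open>The union of the graphs in the window of \<open>B\<close> rounds from
  \<open>t + k\<close> is strongly connected, so one of its edges leaves the reached set. By
  monotonicity the tail of that edge is still reached when the edge appears.\<close>

lemma reached_grows:
  assumes "t \<ge> 1" "B > 0" "reached t j k \<noteq> UNIV"
  shows "reached t j k \<subset> reached t j (k + B)"
proof -
  have j: "j \<in> reached t j k"
    using reached_mono[OF assms(1), of 0 k j] by (auto simp: reached_def mat_def)
  obtain b where b: "b \<notin> reached t j k"
    using assms(3) by blast
  obtain u v where uv: "(u, v) \<in> (\<Union>l\<in>{0..B - 1}. E (t + k + l))"
      "u \<in> reached t j k" "v \<notin> reached t j k"
    using strongly_connected_leaves[OF jointly_connected j b, of "t + k"] assms(1) by auto
  then obtain l where "l \<in> {0..B - 1}" "(u, v) \<in> E (t + k + l)"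
    by blast
  \<comment> \<open>With truncated subtraction, \<open>{0..B - 1}\<close> contains 0 even for
    \<open>B = 0\<close>; positivity of \<open>B\<close> places the edge inside the window.\<close>
  then have l: "l < B" "(u, v) \<in> E (t + (k + l))"
    using assms(2) by (auto simp: add.assoc)
  have "u \<in> reached t j (k + l)"
    using reached_mono[OF assms(1), of k "k + l" j] uv by auto
  then have "v \<in> reached t j (Suc (k + l))"
    using reached_step[OF assms(1)] l by blast
  then have "v \<in> reached t j (k + B)"
    using reached_mono[OF assms(1), of "Suc (k + l)" "k + B" j] l by auto
  with uv(3) reached_mono[OF assms(1), of k "k + B" j] show ?thesis
    by auto
qed

lemma reached_card:
  assumes "t \<ge> 1" "B > 0"
  shows "reached t j (k * B) = UNIV \<or> k \<le> card (reached t j (k * B))"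
proof (induction k)
  case (Suc k)
  show ?case
  proof (cases "reached t j (k * B) = UNIV")
    case True
    then show ?thesis
      using reached_mono[OF assms(1), of "k * B" "Suc k * B" j] by auto
  next
    case False
    then have "card (reached t j (k * B)) < card (reached t j (k * B + B))"
      by (intro psubset_card_mono reached_grows assms) auto
    with Suc False show ?thesis
      by (simp add: add.commute)
  qed
qed simp

text \<open>Each window of \<open>B\<close> rounds adds at least one agent, so after as many windows
  as there are agents every entry is positive, and positive entries have a uniform lower
  bound.\<close>

lemma transition_mixing_time:
  assumes "t \<ge> 1" "B > 0" "w > 0"
  shows "transition W t (CARD('n) * B) $ i $ j \<ge> w ^ (CARD('n) * B)"
proof -
  have "reached t j (CARD('n) * B) = UNIV"
    using reached_card[OF assms(1,2), of j "CARD('n)"]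
    by (metis card_mono card_subset_eq finite_class.finite_UNIV le_antisym subset_UNIV)
  then have "transition W t (CARD('n) * B) $ i $ j > 0"
    by (auto simp: reached_def)
  with assms show ?thesis
    by (intro transition_lower)
qed

text \<open>The entries of a row of the long product sum to 1, and each is at least the uniform
  lower bound.\<close>

lemma contraction_factor_nonneg:
  assumes "B > 0" "w > 0"
  shows "0 \<le> 1 - CARD('n) * w ^ (CARD('n) * B)"
proof -
  fix i :: 'n
  have "(\<Sum>j\<in>(UNIV::'n set). w ^ (CARD('n) * B)) \<le> (\<Sum>j\<in>UNIV. transition W 1 (CARD('n) * B) $ i $ j)"
    using transition_mixing_time[of 1] assms by (intro sum_mono) auto
  also have "\<dots> = 1"
    by (rule transition_row_sum) simp
  finally show ?thesis
    by simp
qed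

text \<open>Row-stochastic averaging never enlarges the maximal error, so perturbations accumulate
  at most additively.\<close>

lemma perturbed_iteration:
  fixes z e :: "'n \<Rightarrow> nat \<Rightarrow> 'a::real_normed_vector" and \<epsilon> :: "nat \<Rightarrow> real"
  assumes t: "t \<ge> 1"
    and z: "\<And>s i. s \<ge> 1 \<Longrightarrow> z i (Suc s) = (\<Sum>j\<in>UNIV. W s $ i $ j *\<^sub>R z j s) + e i s"
    and e: "\<And>s i. s \<ge> 1 \<Longrightarrow> norm (e i s) \<le> \<epsilon> s"
  shows "norm (z i (t + k) - (\<Sum>j\<in>UNIV. transition W t k $ i $ j *\<^sub>R z j t)) \<le> (\<Sum>s=t..<t+k. \<epsilon> s)"
proof (induction k arbitrary: i)
  case 0
  have "(\<Sum>j\<in>UNIV. (mat 1 :: real ^ 'n ^ 'n) $ i $ j *\<^sub>R z j t) = z i t"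
    by (simp add: mat_def if_distrib if_distribR cong: if_cong)
  then show ?case
    by simp
next
  case (Suc k)
  let ?P = "\<lambda>l. \<Sum>j\<in>UNIV. transition W t k $ l $ j *\<^sub>R z j t"
  have P: "(\<Sum>j\<in>UNIV. transition W t (Suc k) $ i $ j *\<^sub>R z j t) = (\<Sum>l\<in>UNIV. W (t + k) $ i $ l *\<^sub>R ?P l)"
    unfolding transition_Suc_nth scaleR_sum_left scaleR_sum_right
    by (subst sum.swap) simp
  have "z i (t + Suc k) - (\<Sum>j\<in>UNIV. transition W t (Suc k) $ i $ j *\<^sub>R z j t)
      = (\<Sum>l\<in>UNIV. W (t + k) $ i $ l *\<^sub>R (z l (t + k) - ?P l)) + e i (t + k)"
    unfolding P using z[of "t + k" i] t by (simp add: scaleR_right_diff_distrib sum_subtractf)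
  also have "norm \<dots> \<le> (\<Sum>l\<in>UNIV. W (t + k) $ i $ l * (\<Sum>s=t..<t+k. \<epsilon> s)) + \<epsilon> (t + k)"
    using t Suc.IH e[of "t + k" i] weight_nonneg[of "t + k" i]
    by (intro norm_triangle_mono sum_norm_le) (auto simp: mult_left_mono)
  also have "\<dots> = (\<Sum>s=t..<t + Suc k. \<epsilon> s)"
    using t row_sum[of "t + k" i] by (simp flip: sum_distrib_right)
  finally show ?case .
qed

text \<open>The diameter at round \<open>t + K\<close> is at most \<rho> times that at round
  \<open>t\<close> plus twice the perturbations in between. Summed over \<open>t\<close>, each
  perturbation lies in at most \<open>K\<close> windows, and the \<rho>-multiple of the total moves
  to the left, leaving the factor \<open>1 - \<rho>\<close>. Half of the factor 4 comes from these
  windows, the other half from the first \<open>K\<close> rounds.\<close>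

lemma consensus_error_sum:
  fixes z e :: "'n \<Rightarrow> nat \<Rightarrow> 'a::real_normed_vector" and \<epsilon> D :: "nat \<Rightarrow> real"
  defines "D \<equiv> \<lambda>t. diameter (range (\<lambda>i. z i t))" and "K \<equiv> CARD('n) * B"
  assumes B: "B > 0" and w: "w > 0"
    and z: "\<And>s i. s \<ge> 1 \<Longrightarrow> z i (Suc s) = (\<Sum>j\<in>UNIV. W s $ i $ j *\<^sub>R z j s) + e i s"
    and e: "\<And>s i. s \<ge> 1 \<Longrightarrow> norm (e i s) \<le> \<epsilon> s"
  shows "CARD('n) * w ^ K * (\<Sum>t=1..T. D t) \<le> K * (D 1 + 4 * (\<Sum>t=1..T. \<epsilon> t))"
proof -
  define \<rho> where "\<rho> = 1 - CARD('n) * w ^ K"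
  have \<epsilon>0: "\<epsilon> s \<ge> 0" if "s \<ge> 1" for s
    using e[OF that] norm_ge_zero order_trans by blast
  have D_bound: "norm (z i t - z j t) \<le> D t" for i j t
    unfolding D_def dist_norm[symmetric]
    by (intro diameter_bounded_bound) (auto intro: finite_imp_bounded)
  have D0: "D t \<ge> 0" for t
    using D_bound[of undefined t undefined] by simp
  \<comment> \<open>Used twice: with \<open>\<delta> = 0\<close> and \<open>c = 1\<close> for the
    initial rounds, and with \<open>\<delta> = w ^ K\<close> for the contraction.\<close>
  have step: "D (t + k) \<le> c * D t + 2 * (\<Sum>s=t..<t+k. \<epsilon> s)"
    if t: "t \<ge> 1" and \<delta>: "\<And>i j. transition W t k $ i $ j \<ge> \<delta>" and c: "c = 1 - CARD('n) * \<delta>" for t k and \<delta> c :: real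
    unfolding D_def
  proof (intro diameter_le disjI1)
    fix a b
    assume "a \<in> range (\<lambda>i. z i (t + k))" "b \<in> range (\<lambda>i. z i (t + k))"
    then obtain i j where ij: "a = z i (t + k)" "b = z j (t + k)"
      by blast
    let ?P = "\<lambda>l. \<Sum>j\<in>UNIV. transition W t k $ l $ j *\<^sub>R z j t"
    have "norm (?P i - ?P j) \<le> c * D t"
      unfolding c using t \<delta> D_bound
      by (intro dobrushin_contraction transition_row_sum) auto
    moreover have "norm (z i (t + k) - ?P i) \<le> (\<Sum>s=t..<t+k. \<epsilon> s)"
      "norm (z j (t + k) - ?P j) \<le> (\<Sum>s=t..<t+k. \<epsilon> s)"
      by (rule perturbed_iteration[OF t z e]; assumption)+
    moreover have "norm (z i (t + k) - z j (t + k))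
        \<le> norm (z i (t + k) - ?P i) + norm (?P i - ?P j) + norm (z j (t + k) - ?P j)"
      by norm
    ultimately show "norm (a - b) \<le> c * diameter (range (\<lambda>i. z i t)) + 2 * (\<Sum>s=t..<t+k. \<epsilon> s)"
      unfolding ij D_def by linarith
  qed auto
  let ?S = "\<Sum>t=1..T. \<epsilon> t"
  have \<epsilon>_le: "(\<Sum>s=a..<b. \<epsilon> s) \<le> ?S" if "1 \<le> a" "b \<le> Suc T" for a b
    using that by (intro sum_mono2) (auto simp: \<epsilon>0)
  have start: "D t \<le> D 1 + 2 * ?S" if "1 \<le> t" "t \<le> T" for t
    using step[of 1 0 "t - 1" 1] \<epsilon>_le[of 1 t] that by (simp add: transition_nonneg)
  have "0 \<le> \<rho>"
    unfolding \<rho>_def by (unfold K_def, rule contraction_factor_nonneg[OF B w])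
  have K: "K > 0"
    using B by (simp add: K_def)
  have S0: "?S \<ge> 0" and S'0: "(\<Sum>t=1..T. D t) \<ge> 0"
    by (auto intro!: sum_nonneg simp: \<epsilon>0 D0)
  \<comment> \<open>The first \<open>K\<close> rounds have no round \<open>t - K\<close> to contract
    from; \<open>min K T\<close> covers short horizons.\<close>
  have "(\<Sum>t=1..T. D t) \<le> (\<Sum>t=1..min K T. D t) + (\<Sum>t=K+1..T. D t)"
  proof -
    have "{1..T} = {1..min K T} \<union> {K+1..T}"
      by auto
    then show ?thesis
      using D0 by (simp add: sum.union_disjoint)
  qed
  also have "(\<Sum>t=1..min K T. D t) \<le> (\<Sum>t=1..min K T. D 1 + 2 * ?S)"
    by (intro sum_mono start) auto
  also have "\<dots> \<le> K * (D 1 + 2 * ?S)"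
    using D0[of 1] S0 by (simp add: mult_right_mono)
  also have "(\<Sum>t=K+1..T. D t) = (\<Sum>t=1..T-K. D (t + K))"
    using sum.shift_bounds_cl_nat_ivl[of D 1 K "T - K"]
    by (cases "K \<le> T") auto
  also have "\<dots> \<le> (\<Sum>t=1..T-K. \<rho> * D t + 2 * (\<Sum>s=t..<t+K. \<epsilon> s))"
    using step transition_mixing_time[OF _ B w] unfolding \<rho>_def K_def
    by (intro sum_mono) auto
  also have "\<dots> = \<rho> * (\<Sum>t=1..T-K. D t) + 2 * (\<Sum>t=1..T-K. \<Sum>k<K. \<epsilon> (t + k))"
  proof -
    have "(\<Sum>s=t..<t+K. \<epsilon> s) = (\<Sum>k<K. \<epsilon> (t + k))" for t
      using sum.shift_bounds_nat_ivl[of \<epsilon> 0 t K] by (simp add: lessThan_atLeast0 add.commute)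
    then show ?thesis
      by (simp add: sum.distrib sum_distrib_left)
  qed
  \<comment> \<open>For each fixed offset \<open>k\<close> the shifted rounds stay within
    \<open>{1..T}\<close>.\<close>
  also have "(\<Sum>t=1..T-K. \<Sum>k<K. \<epsilon> (t + k)) \<le> (\<Sum>k<K. ?S)"
  proof (subst sum.swap, rule sum_mono)
    fix k assume k: "k \<in> {..<K}"
    have "(\<Sum>t=1..T-K. \<epsilon> (t + k)) = (\<Sum>t=1+k..T-K+k. \<epsilon> t)"
      by (rule sum.shift_bounds_cl_nat_ivl[symmetric])
    also have "\<dots> \<le> ?S"
      using k by (intro sum_mono2) (auto simp: \<epsilon>0)
    finally show "(\<Sum>t=1..T-K. \<epsilon> (t + k)) \<le> ?S" .
  qed
  finally have "(\<Sum>t=1..T. D t) \<le> K * (D 1 + 2 * ?S) + (\<rho> * (\<Sum>t=1..T-K. D t) + 2 * (\<Sum>k<K. ?S))"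
    by simp
  moreover have "\<rho> * (\<Sum>t=1..T-K. D t) \<le> \<rho> * (\<Sum>t=1..T. D t)"
    using \<open>0 \<le> \<rho>\<close> by (intro mult_left_mono sum_mono2) (auto simp: D0)
  ultimately have "(\<Sum>t=1..T. D t) \<le> K * (D 1 + 2 * ?S) + (\<rho> * (\<Sum>t=1..T. D t) + 2 * (\<Sum>k<K. ?S))"
    by linarith
  then show ?thesis
    by (simp add: \<rho>_def algebra_simps)
qed

end

subsection \<open>Constraint Jacobians and losses\<close>

text \<open>The supremum over reals is usable because the quotients are bounded above by the sum of
  the row norms.\<close>

lemma L2_set_rows_le_induced_norm:
  fixes A :: "nat \<Rightarrow> 'a::real_inner"
  shows "L2_set (\<lambda>k. A k \<bullet> v) {..<d} \<le> induced_norm d A * norm v"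
proof (cases "v = 0")
  case True
  then show ?thesis
    by (simp add: L2_set_def)
next
  case False
  have "L2_set (\<lambda>k. A k \<bullet> u) {..<d} / norm u \<le> (\<Sum>k<d. norm (A k))" for u
  proof (cases "u = 0")
    case False
    have "L2_set (\<lambda>k. A k \<bullet> u) {..<d} \<le> (\<Sum>k<d. \<bar>A k \<bullet> u\<bar>)"
      by (rule L2_set_le_sum_abs)
    also have "\<dots> \<le> (\<Sum>k<d. norm (A k) * norm u)"
      by (intro sum_mono Cauchy_Schwarz_ineq2)
    finally show ?thesis
      using False by (simp add: divide_simps sum_distrib_right)
  qed (simp add: sum_nonneg)
  then have "L2_set (\<lambda>k. A k \<bullet> v) {..<d} / norm v \<le> induced_norm d A"
    unfolding induced_norm_def by (intro cSUP_upper bdd_aboveI2) auto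
  with False show ?thesis
    by (simp add: divide_simps)
qed

text \<open>The left side is the inner product of the transposed matrix applied to \<open>c\<close>
  with \<open>v\<close>; moving the matrix to \<open>v\<close> allows Cauchy-Schwarz.\<close>

lemma sum_rows_le_induced_norm:
  fixes A :: "nat \<Rightarrow> 'a::real_inner"
  shows "(\<Sum>k<d. c k * (A k \<bullet> v)) \<le> L2_set c {..<d} * (induced_norm d A * norm v)"
proof -
  have "(\<Sum>k<d. c k * (A k \<bullet> v)) \<le> (\<Sum>k<d. \<bar>c k\<bar> * \<bar>A k \<bullet> v\<bar>)"
    by (intro sum_mono) (metis abs_ge_self abs_mult)
  also have "\<dots> \<le> L2_set c {..<d} * L2_set (\<lambda>k. A k \<bullet> v) {..<d}"
    by (rule L2_set_mult_ineq)
  also have "\<dots> \<le> L2_set c {..<d} * (induced_norm d A * norm v)"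
    by (intro mult_left_mono L2_set_rows_le_induced_norm) simp
  finally show ?thesis .
qed

definition violation :: "nat \<Rightarrow> (nat \<Rightarrow> real) \<Rightarrow> real" where
  "violation d c = L2_set (\<lambda>k. pos_part (c k)) {..<d}"

lemma pos_part_nonneg [simp]: "pos_part a \<ge> 0"
  by (simp add: pos_part_def)

lemma pos_part_mult_self: "pos_part a * a = (pos_part a)\<^sup>2"
  by (simp add: pos_part_def max_def power2_eq_square)

lemma violation_nonneg [simp]: "violation d c \<ge> 0"
  by (simp add: violation_def)

lemma violation_power2: "(violation d c)\<^sup>2 = (\<Sum>k<d. (pos_part (c k))\<^sup>2)"
  by (simp add: violation_def L2_set_def sum_nonneg)

lemma violation_le_sum: "violation d c \<le> (\<Sum>k<d. pos_part (c k))"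
  unfolding violation_def by (rule L2_set_le_sum) simp

text \<open>The norm of a stacked vector is the Euclidean norm of its block norms, which is at most
  their sum.\<close>

lemma stacked_violation_le:
  fixes m :: "'n::finite \<Rightarrow> nat"
  shows "L2_set (\<lambda>(j, k). pos_part (c j k)) (SIGMA j:UNIV. {..<m j}) \<le> (\<Sum>j\<in>UNIV. violation (m j) (c j))"
proof -
  have "L2_set (\<lambda>(j, k). pos_part (c j k)) (SIGMA j:UNIV. {..<m j})
      = L2_set (\<lambda>j. violation (m j) (c j)) UNIV"
    by (simp add: L2_set_def sum.Sigma violation_power2 case_prod_beta')
  also have "\<dots> \<le> (\<Sum>j\<in>UNIV. violation (m j) (c j))"
    by (rule L2_set_le_sum) simp
  finally show ?thesis .
qed

context online_problem
begin

lemma Jacobian_bound: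
  assumes "t \<ge> 1" "y \<in> X"
  shows "induced_norm (m i) (dg i t y) \<le> G2"
  using assms by (intro bound_g[of t y i]) (auto intro: subgradient_g)

text \<open>The subgradient at \<open>a\<close> bounds the increase of each component from
  \<open>b\<close> to \<open>a\<close>; Minkowski's inequality and the induced norm collect the
  components.\<close>

lemma violation_lipschitz:
  assumes t: "t \<ge> 1" and a: "a \<in> X"
  shows "violation (m i) (g i t a) \<le> violation (m i) (g i t b) + G2 * norm (a - b)"
proof -
  have "violation (m i) (g i t a)
      \<le> L2_set (\<lambda>k. pos_part (g i t b k) + \<bar>dg i t a k \<bullet> (a - b)\<bar>) {..<m i}"
    unfolding violation_def
  proof (intro L2_set_mono)
    fix k assume "k \<in> {..<m i}"
    then have "g i t a k \<le> g i t b k + dg i t a k \<bullet> (a - b)"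
      using subgradient_g[OF t a, of k i] unfolding subgradient_def
      by (simp add: inner_diff_right) (smt (verit))
    then show "pos_part (g i t a k) \<le> pos_part (g i t b k) + \<bar>dg i t a k \<bullet> (a - b)\<bar>"
      by (simp add: pos_part_def)
  qed simp
  also have "\<dots> \<le> violation (m i) (g i t b) + L2_set (\<lambda>k. \<bar>dg i t a k \<bullet> (a - b)\<bar>) {..<m i}"
    unfolding violation_def by (rule L2_set_triangle_ineq)
  also have "L2_set (\<lambda>k. \<bar>dg i t a k \<bullet> (a - b)\<bar>) {..<m i} \<le> induced_norm (m i) (dg i t a) * norm (a - b)"
    using L2_set_rows_le_induced_norm[of "dg i t a" "a - b" "m i"] by (simp add: L2_set_def)
  also have "\<dots> \<le> G2 * norm (a - b)"
    using Jacobian_bound[OF t a] by (rule mult_right_mono) simp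
  finally show ?thesis
    by simp
qed

text \<open>The hypotheses bound subgradients of the sum of \<open>f\<close> and \<open>r\<close>
  only, so the linear term of \<open>f\<close> and the increment of \<open>r\<close> are estimated
  together.\<close>

lemma linearized_loss_bound:
  assumes t: "t \<ge> 1" and a: "a \<in> X"
  shows "df i t a \<bullet> (a - b) + (r t a - r t b) \<le> G1 * norm (a - b)"
proof -
  obtain s where s: "subgradient (r t) a s"
    using subgradient_r[OF t a] by blast
  have "r t a - r t b \<le> s \<bullet> (a - b)"
    using s unfolding subgradient_def by (simp add: inner_diff_right) (smt (verit))
  then have "df i t a \<bullet> (a - b) + (r t a - r t b) \<le> (df i t a + s) \<bullet> (a - b)"
    by (simp add: inner_add_left)
  also have "\<dots> \<le> norm (df i t a + s) * norm (a - b)"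
    by (rule norm_cauchy_schwarz)
  also have "\<dots> \<le> G1 * norm (a - b)"
    using bound_l[OF t a subgradient_f[OF t a] s] by (rule mult_right_mono) simp
  finally show ?thesis .
qed

lemma loss_lipschitz:
  assumes t: "t \<ge> 1" and a: "a \<in> X"
  shows "(f i t a + r t a) - (f i t b + r t b) \<le> G1 * norm (a - b)"
proof -
  have "f i t a - f i t b \<le> df i t a \<bullet> (a - b)"
    using subgradient_f[OF t a] unfolding subgradient_def by (simp add: inner_diff_right) (smt (verit))
  then show ?thesis
    using linearized_loss_bound[OF t a, of i b] by linarith
qed

lemma continuous_avg_loss:
  "t \<ge> 1 \<Longrightarrow> continuous_on UNIV (avg_loss (\<lambda>i t y. f i t y + r t y) t)"
  unfolding avg_loss_def
  by (intro continuous_on_divide continuous_on_sum continuous_on_add continuous_on_const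
      convex_on_continuous open_UNIV convex_f convex_r) auto

lemma closed_feasible_set: "closed (feasible_set X m g T)"
proof -
  have "feasible_set X m g T = X \<inter> (\<Inter>t\<in>{1..T}. \<Inter>i. \<Inter>k\<in>{..<m i}. {y. g i t y k \<le> 0})"
    by (auto simp: feasible_set_def)
  also have "closed \<dots>"
    by (intro closed_Int closed_X closed_INT ballI closed_Collect_le continuous_on_const
        convex_on_continuous convex_g) auto
  finally show ?thesis .
qed

text \<open>\<open>LEAST\<close> on the reals has its intended value once the minimum is attained:
  the loss is continuous and the feasible set is compact.\<close>

lemma regret_minimum_attained:
  assumes T: "T \<ge> 1" and X: "bounded X"
  obtains y where "y \<in> feasible_set X m g T"
    "(LEAST v. v \<in> (\<lambda>y. \<Sum>t=1..T. avg_loss (\<lambda>i t y. f i t y + r t y) t y) ` feasible_set X m g T)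
       = (\<Sum>t=1..T. avg_loss (\<lambda>i t y. f i t y + r t y) t y)"
proof -
  let ?L = "\<lambda>y. \<Sum>t=1..T. avg_loss (\<lambda>i t y. f i t y + r t y) t y"
  have "bounded (feasible_set X m g T)"
    using X by (rule bounded_subset) (auto simp: feasible_set_def)
  then have "compact (feasible_set X m g T)"
    using closed_feasible_set by (simp add: compact_eq_bounded_closed)
  moreover have "continuous_on (feasible_set X m g T) ?L"
    by (intro continuous_on_sum continuous_on_subset[OF continuous_avg_loss]) auto
  ultimately obtain y where "y \<in> feasible_set X m g T" "\<forall>u\<in>feasible_set X m g T. ?L y \<le> ?L u"
    using continuous_attains_inf feasible[OF T] by blast
  then show ?thesis
    by (intro that[of y] Least_equality) auto
qed

end

subsection \<open>The mirror step\<close>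

lemma bregman_self [simp]: "bregman \<psi> d\<psi> x x = 0"
  by (simp add: bregman_def)

lemma bregman_three_point:
  "(d\<psi> z - d\<psi> x) \<bullet> (y - z) = bregman \<psi> d\<psi> y x - bregman \<psi> d\<psi> y z - bregman \<psi> d\<psi> z x"
  by (simp add: bregman_def inner_diff_left inner_diff_right)

context mirror_map
begin

lemma bregman_lower:
  assumes "x \<in> X" "y \<in> X"
  shows "\<sigma> / 2 * (norm (x - y))\<^sup>2 \<le> bregman \<psi> d\<psi> x y"
  using strong_convexity[OF assms] by (simp add: bregman_def)

text \<open>The first-order condition for the minimizer, with the difference quotient of the convex
  term \<open>h\<close> bounded by its increment towards \<open>y\<close>.\<close>

lemma mirror_step_optimality:
  assumes X: "convex X" and h: "convex_on X h" and y: "y \<in> X"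
    and z: "is_arg_min (\<lambda>u. u \<bullet> v + h u + bregman \<psi> d\<psi> u x) (\<lambda>u. u \<in> X) z"
  shows "(z - y) \<bullet> v + (h z - h y) \<le> bregman \<psi> d\<psi> y x - bregman \<psi> d\<psi> y z - bregman \<psi> d\<psi> z x"
proof -
  have zX: "z \<in> X" and min: "\<And>u. u \<in> X \<Longrightarrow>
      z \<bullet> v + h z + bregman \<psi> d\<psi> z x \<le> u \<bullet> v + h u + bregman \<psi> d\<psi> u x"
    using z by (auto simp: is_arg_min_linorder)
  let ?c = "(z - y) \<bullet> v + (h z - h y) + d\<psi> x \<bullet> (y - z)"
  \<comment> \<open>Compare \<open>z\<close> with a point of the segment towards \<open>y\<close>.
    All terms except \<psi> are linear in \<open>s\<close> or bounded by convexity, so division by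
    \<open>s\<close> leaves one difference quotient, whose limit at 0 from the right is the gradient
    term.\<close>
  have quot: "?c \<le> (\<psi> (z + s *\<^sub>R (y - z)) - \<psi> z) / s" if s: "0 < s" "s \<le> 1" for s
  proof -
    let ?u = "(1 - s) *\<^sub>R z + s *\<^sub>R y"
    have u: "?u = z + s *\<^sub>R (y - z)"
      by (simp add: algebra_simps)
    have "?u \<in> X"
      using X zX y s by (intro convexD) auto
    moreover have "h ?u \<le> (1 - s) * h z + s * h y"
      using h zX y s by (intro convex_onD) auto
    ultimately have "z \<bullet> v + h z + bregman \<psi> d\<psi> z x
        \<le> ?u \<bullet> v + ((1 - s) * h z + s * h y) + bregman \<psi> d\<psi> ?u x"
      using min[of ?u] by linarith
    then have "s * ?c \<le> \<psi> ?u - \<psi> z"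
      by (simp add: bregman_def algebra_simps inner_add_left inner_diff_left inner_diff_right)
    with s show ?thesis
      unfolding u by (simp add: field_simps)
  qed
  have "((\<lambda>s. \<psi> (z + s *\<^sub>R (y - z))) has_derivative (\<lambda>s. (s *\<^sub>R (y - z)) \<bullet> d\<psi> z)) (at 0)"
    using gradient[OF zX] unfolding gderiv_def
    by (intro has_derivative_compose[of "\<lambda>s. z + s *\<^sub>R (y - z)" "\<lambda>s. s *\<^sub>R (y - z)" 0 UNIV \<psi>])
      (auto intro!: derivative_eq_intros)
  then have "((\<lambda>s. \<psi> (z + s *\<^sub>R (y - z))) has_field_derivative (d\<psi> z \<bullet> (y - z))) (at 0)"
    by (rule has_derivative_imp_has_field_derivative) (simp add: inner_commute)
  then have "((\<lambda>s. (\<psi> (z + s *\<^sub>R (y - z)) - \<psi> z) / s) \<longlongrightarrow> d\<psi> z \<bullet> (y - z)) (at_right 0)"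
    unfolding DERIV_def by (auto intro: filterlim_at_split[THEN iffD1, THEN conjunct2])
  then have "?c \<le> d\<psi> z \<bullet> (y - z)"
    by (rule tendsto_lowerbound)
      (auto intro!: quot eventually_at_rightI[of 0 1])
  then show ?thesis
    using bregman_three_point[of d\<psi> z x y \<psi>] by (simp add: inner_diff_left)
qed

end

subsection \<open>The algorithm\<close>

locale mirror_descent =
  online_problem X m f r g df dg F G1 G2 + mixing_network E W w B + mirror_map X \<psi> d\<psi> \<sigma>
  for X :: "(real ^ 'p) set" and m :: "'n::finite \<Rightarrow> nat" and f r g df dg F G1 G2
    and E and W :: "nat \<Rightarrow> real ^ 'n ^ 'n" and w B and \<psi> d\<psi> \<sigma> +
  fixes \<mu> \<gamma>0 :: real and \<alpha> \<gamma> z1 x z q \<omega>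
  assumes G1_pos: "G1 > 0" and G2_pos: "G2 > 0" and w_pos: "w > 0" and B_pos: "B > 0"
    and \<sigma>_pos: "\<sigma> > 0" and \<mu>_pos: "\<mu> > 0" and \<gamma>0_pos: "\<gamma>0 > 0" and \<gamma>0_le: "\<gamma>0 \<le> \<sigma> / (4 * G2\<^sup>2)"
    and relative_strong_convexity: "\<And>i t x y. t \<ge> 1 \<Longrightarrow> x \<in> X \<Longrightarrow> y \<in> X \<Longrightarrow>
          f i t x \<ge> f i t y + (x - y) \<bullet> df i t y + \<mu> * bregman \<psi> d\<psi> x y"
    and \<alpha>_eq: "\<And>t. t \<ge> 1 \<Longrightarrow> \<alpha> t = 1 / (\<mu> * real t)"
    and \<gamma>_eq: "\<And>t. t \<ge> 1 \<Longrightarrow> \<gamma> t = \<gamma>0 / \<alpha> t"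
    and run: "mirror_descent_run X \<psi> d\<psi> m r g df dg W \<alpha> \<gamma> z1 x z q \<omega>"
begin

abbreviation loss :: "'n \<Rightarrow> nat \<Rightarrow> real ^ 'p \<Rightarrow> real" where
  "loss i t y \<equiv> f i t y + r t y"

abbreviation own_violation :: "'n \<Rightarrow> nat \<Rightarrow> real" where
  "own_violation i t \<equiv> violation (m i) (g i t (x i t))"

section \<open>Feasibility of the iterates and boundedness of the domain\<close>

lemma z_1: "z i 1 = z1 i"
  using run unfolding mirror_descent_run_def by blast

lemma z_1_in: "z i 1 \<in> X"
  using run unfolding mirror_descent_run_def by simp

lemma x_eq: "t \<ge> 1 \<Longrightarrow> x i t = (\<Sum>j\<in>UNIV. W t $ i $ j *\<^sub>R z j t)"
  and q_eq: "t \<ge> 1 \<Longrightarrow> k < m i \<Longrightarrow> q i (t + 1) k = \<gamma> t * pos_part (g i t (x i t) k)"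
  and \<omega>_eq: "t \<ge> 1 \<Longrightarrow>
        \<omega> i (t + 1) = df i t (x i t) + (\<Sum>k<m i. q i (t + 1) k *\<^sub>R dg i t (x i t) k)"
  and z_arg_min: "t \<ge> 1 \<Longrightarrow> is_arg_min
        (\<lambda>y. \<alpha> t * (y \<bullet> \<omega> i (t + 1)) + \<alpha> t * r t y + bregman \<psi> d\<psi> y (x i t)) (\<lambda>y. y \<in> X) (z i (t + 1))"
  using run unfolding mirror_descent_run_def by blast+

lemma z_in: "t \<ge> 1 \<Longrightarrow> z i t \<in> X"
  using z_1_in[of i] z_arg_min[of "t - 1" i]
  by (cases "t = 1") (auto simp: is_arg_min_def)

lemma x_in: "t \<ge> 1 \<Longrightarrow> x i t \<in> X"
  unfolding x_eq using convex_X
  by (intro convex_sum) (auto simp: row_sum weight_nonneg z_in)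

lemma \<alpha>_pos: "t \<ge> 1 \<Longrightarrow> \<alpha> t > 0"
  using \<mu>_pos by (simp add: \<alpha>_eq)

lemma \<gamma>_eq': "t \<ge> 1 \<Longrightarrow> \<gamma> t = \<gamma>0 * \<mu> * t"
  by (simp add: \<gamma>_eq \<alpha>_eq)

text \<open>Relative strong convexity forces quadratic growth of the loss with at most a linear
  correction, while its variation is at most \<open>F\<close>. Hence distances in \<open>X\<close>
  are bounded and the regret minimum is attained.\<close>

lemma bounded_X: "bounded X"
proof -
  \<comment> \<open>A distance \<open>d > 1\<close> satisfies \<open>\<mu> * \<sigma> / 2 * d^2
    \<le> F + G1 * d \<le> (F + G1) * d\<close>.\<close>
  let ?R = "max 1 ((F + G1) / (\<mu> * \<sigma> / 2))"
  have "norm (a - b) \<le> ?R" if a: "a \<in> X" and b: "b \<in> X" for a b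
  proof (cases "norm (a - b) \<le> 1")
    case False
    fix i :: 'n
    have "f i 1 b \<ge> f i 1 a + (b - a) \<bullet> df i 1 a + \<mu> * bregman \<psi> d\<psi> b a"
      using a b by (intro relative_strong_convexity) auto
    moreover have "\<mu> * (\<sigma> / 2 * (norm (a - b))\<^sup>2) \<le> \<mu> * bregman \<psi> d\<psi> b a"
      using bregman_lower[OF b a] \<mu>_pos by (simp add: norm_minus_commute)
    moreover have "df i 1 a \<bullet> (a - b) + (r 1 a - r 1 b) \<le> G1 * norm (a - b)"
      using a by (intro linearized_loss_bound) auto
    moreover have "df i 1 a \<bullet> (a - b) = - ((b - a) \<bullet> df i 1 a)"
      by (simp add: inner_diff_left inner_diff_right inner_commute)
    moreover have F: "\<bar>loss i 1 b - loss i 1 a\<bar> \<le> F"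
      using a b by (intro loss_variation) auto
    ultimately have "\<mu> * (\<sigma> / 2 * (norm (a - b))\<^sup>2) \<le> F + G1 * norm (a - b)"
      by linarith
    moreover have "F * 1 \<le> F * norm (a - b)"
      using F False by (intro mult_left_mono) auto
    ultimately have "\<mu> * \<sigma> / 2 * (norm (a - b))\<^sup>2 \<le> (F + G1) * norm (a - b)"
      by (simp add: distrib_right)
    then have "(\<mu> * \<sigma> / 2 * norm (a - b)) * norm (a - b) \<le> (F + G1) * norm (a - b)"
      by (simp only: power2_eq_square mult.assoc)
    then have "\<mu> * \<sigma> / 2 * norm (a - b) \<le> F + G1"
      by (rule mult_right_le_imp_le) (use False in linarith)
    then show ?thesis
      using \<mu>_pos \<sigma>_pos by (simp add: field_simps le_max_iff_disj)
  qed simp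
  then show ?thesis
    unfolding bounded_two_points dist_norm by blast
qed

section \<open>One round of the algorithm\<close>

lemma prox_optimality:
  assumes t: "t \<ge> 1" and y: "y \<in> X"
  shows "\<alpha> t * ((z i (t + 1) - y) \<bullet> \<omega> i (t + 1)) + \<alpha> t * (r t (z i (t + 1)) - r t y)
    \<le> bregman \<psi> d\<psi> y (x i t) - bregman \<psi> d\<psi> y (z i (t + 1)) - bregman \<psi> d\<psi> (z i (t + 1)) (x i t)"
proof -
  have "convex_on X (r t)"
    using convex_on_subset[OF convex_r[OF t]] convex_X by blast
  then have "convex_on X (\<lambda>u. \<alpha> t * r t u)"
    using \<alpha>_pos[OF t] by (intro convex_on_cmul) auto
  from mirror_step_optimality[OF convex_X this y, of "\<alpha> t *\<^sub>R \<omega> i (t + 1)" "x i t" "z i (t + 1)"]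
  show ?thesis
    using z_arg_min[OF t] by (simp add: right_diff_distrib)
qed

lemma inner_\<omega>:
  assumes t: "t \<ge> 1"
  shows "\<omega> i (t + 1) \<bullet> v = df i t (x i t) \<bullet> v +
    \<gamma> t * (\<Sum>k<m i. pos_part (g i t (x i t) k) * (dg i t (x i t) k \<bullet> v))"
proof -
  have "(\<Sum>k<m i. q i (t + 1) k *\<^sub>R dg i t (x i t) k) \<bullet> v
      = (\<Sum>k<m i. \<gamma> t * (pos_part (g i t (x i t) k) * (dg i t (x i t) k \<bullet> v)))"
    unfolding inner_sum_left by (intro sum.cong) (simp_all only: q_eq[OF t] lessThan_iff inner_scaleR_left mult.assoc)
  then show ?thesis
    unfolding \<omega>_eq[OF t] by (simp only: inner_add_left sum_distrib_left)
qed

text \<open>The penalty weight grows with \<open>t\<close>, but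
  \<open>\<alpha> t * \<gamma> t = \<gamma>0\<close>, so the constraint gradients enter with a
  coefficient independent of \<open>t\<close>.\<close>

lemma forward_step_bound:
  assumes t: "t \<ge> 1" and u: "u \<in> X"
  shows "\<alpha> t * (\<omega> i (t + 1) \<bullet> (x i t - u)) + \<alpha> t * (r t (x i t) - r t u)
    \<le> (\<alpha> t * G1 + \<gamma>0 * G2 * own_violation i t) * norm (x i t - u)"
proof -
  let ?A = "\<Sum>k<m i. pos_part (g i t (x i t) k) * (dg i t (x i t) k \<bullet> (x i t - u))"
  have "?A \<le> own_violation i t * (induced_norm (m i) (dg i t (x i t)) * norm (x i t - u))"
    unfolding violation_def by (rule sum_rows_le_induced_norm)
  also have "\<dots> \<le> own_violation i t * (G2 * norm (x i t - u))"
    using Jacobian_bound[OF t x_in[OF t]] by (intro mult_left_mono mult_right_mono) auto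
  finally have "\<gamma>0 * ?A \<le> \<gamma>0 * (G2 * (own_violation i t * norm (x i t - u)))"
    using \<gamma>0_pos by (simp add: mult.left_commute)
  moreover have "\<alpha> t * (df i t (x i t) \<bullet> (x i t - u) + (r t (x i t) - r t u)) \<le> \<alpha> t * (G1 * norm (x i t - u))"
    using \<alpha>_pos[OF t] linearized_loss_bound[OF t x_in[OF t]] by simp
  moreover have "\<alpha> t * \<gamma> t = \<gamma>0"
    using \<alpha>_pos[OF t] by (simp add: \<gamma>_eq[OF t])
  then have "\<alpha> t * (\<gamma> t * ?A) = \<gamma>0 * ?A"
    by (simp only: mult.assoc[symmetric])
  ultimately show ?thesis
    unfolding inner_\<omega>[OF t] distrib_left distrib_right by (simp only: mult.assoc)
qed

text \<open>Test optimality against \<open>x i t\<close> itself: the divergences in both directions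
  remain, and together they dominate \<sigma> times the squared distance.\<close>

lemma displacement_bound:
  assumes t: "t \<ge> 1"
  shows "norm (z i (t + 1) - x i t) \<le> (\<alpha> t * G1 + \<gamma>0 * G2 * own_violation i t) / \<sigma>"
proof -
  let ?z = "z i (t + 1)" and ?x = "x i t"
  let ?e = "norm (?x - ?z)"
  have z: "?z \<in> X" and x: "?x \<in> X"
    using t by (auto intro: z_in x_in)
  have "\<sigma> * ?e\<^sup>2 \<le> bregman \<psi> d\<psi> ?x ?z + bregman \<psi> d\<psi> ?z ?x"
    using bregman_lower[OF x z] bregman_lower[OF z x] by (simp add: norm_minus_commute)
  also have "\<dots> \<le> \<alpha> t * (\<omega> i (t + 1) \<bullet> (?x - ?z)) + \<alpha> t * (r t ?x - r t ?z)"
    using prox_optimality[OF t x, of i]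
    by (simp add: inner_diff_left inner_diff_right inner_commute algebra_simps)
  also have "\<dots> \<le> (\<alpha> t * G1 + \<gamma>0 * G2 * own_violation i t) * ?e"
    by (rule forward_step_bound[OF t z])
  finally have "?e * (\<sigma> * ?e) \<le> ?e * (\<alpha> t * G1 + \<gamma>0 * G2 * own_violation i t)"
    by (simp add: power2_eq_square mult.commute mult.left_commute)
  moreover have "0 \<le> \<alpha> t * G1 + \<gamma>0 * G2 * own_violation i t"
    using \<alpha>_pos[OF t] G1_pos G2_pos \<gamma>0_pos by simp
  ultimately have "\<sigma> * ?e \<le> \<alpha> t * G1 + \<gamma>0 * G2 * own_violation i t"
    by (cases "?e = 0") (auto simp: mult_le_cancel_left)
  then show ?thesis
    using \<sigma>_pos by (simp add: field_simps norm_minus_commute)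
qed

text \<open>Maximizing over \<open>e\<close> gives the square of the linear coefficient over
  \<open>2 * \<sigma>\<close>. The upper bound on \<gamma>0 makes the constraint part at most
  \<open>\<gamma>0 / 4 * v\<^sup>2\<close>, a quarter of the penalty term.\<close>

lemma young_step:
  assumes "a \<ge> 0" "v \<ge> 0"
  shows "(a * G1 + \<gamma>0 * G2 * v) * e - \<sigma> / 2 * e\<^sup>2 \<le> a\<^sup>2 * G1\<^sup>2 / \<sigma> + \<gamma>0 / 4 * v\<^sup>2"
proof -
  let ?A = "a * G1 + \<gamma>0 * G2 * v"
  have "0 \<le> (?A - \<sigma> * e)\<^sup>2"
    by simp
  then have "?A * e - \<sigma> / 2 * e\<^sup>2 \<le> ?A\<^sup>2 / (2 * \<sigma>)"
    using \<sigma>_pos by (simp add: field_simps power2_eq_square)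
  also have "?A\<^sup>2 \<le> 2 * (a * G1)\<^sup>2 + 2 * (\<gamma>0 * G2 * v)\<^sup>2"
    using sum_squares_bound[of "a * G1" "\<gamma>0 * G2 * v"] by (simp add: power2_sum)
  also have "(\<gamma>0 * G2 * v)\<^sup>2 = \<gamma>0 * G2\<^sup>2 * (\<gamma>0 * v\<^sup>2)"
    by (simp add: power2_eq_square)
  also have "\<dots> \<le> \<sigma> / 4 * (\<gamma>0 * v\<^sup>2)"
    using \<gamma>0_le \<gamma>0_pos G2_pos by (intro mult_right_mono) (simp_all add: field_simps)
  finally show ?thesis
    using \<sigma>_pos by (simp add: field_simps)
qed

text \<open>Convexity makes the penalty gradient, tested against \<open>x i t - y\<close>, at least
  \<gamma> times the squared violation plus the Slater gain. Young's inequality consumes a quarter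
  of the square, and relative strong convexity supplies the term with \<mu>. The estimate is scaled
  by \<alpha> until the end.\<close>

lemma one_step:
  assumes t: "t \<ge> 1" and y: "y \<in> X" and \<epsilon>: "\<epsilon> \<ge> 0"
    and gy: "\<And>k. k < m i \<Longrightarrow> g i t y k \<le> - \<epsilon>"
  shows "loss i t (x i t) - loss i t y + \<epsilon> * \<gamma> t * own_violation i t + 3 / 4 * \<gamma> t * (own_violation i t)\<^sup>2
    \<le> \<alpha> t * G1\<^sup>2 / \<sigma> + (1 / \<alpha> t - \<mu>) * bregman \<psi> d\<psi> y (x i t) - 1 / \<alpha> t * bregman \<psi> d\<psi> y (z i (t + 1))"
proof -
  let ?z = "z i (t + 1)" and ?x = "x i t" and ?v = "own_violation i t" and ?a = "\<alpha> t"
  let ?A = "\<Sum>k<m i. pos_part (g i t ?x k) * (dg i t ?x k \<bullet> (?x - y))"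
  have z: "?z \<in> X" and x: "?x \<in> X"
    using t by (auto intro: z_in x_in)
  have a: "?a > 0" and a\<gamma>: "?a * \<gamma> t = \<gamma>0" and \<gamma>: "\<gamma> t > 0"
    using \<alpha>_pos[OF t] \<gamma>0_pos by (simp_all add: \<gamma>_eq[OF t])
  \<comment> \<open>The sum of the positive parts dominates their Euclidean norm, so the margin
    \<epsilon> yields a term linear in the violation.\<close>
  have "?v\<^sup>2 + \<epsilon> * ?v \<le> (\<Sum>k<m i. (pos_part (g i t ?x k))\<^sup>2) + \<epsilon> * (\<Sum>k<m i. pos_part (g i t ?x k))"
    unfolding violation_power2 using \<epsilon> by (intro add_left_mono mult_left_mono violation_le_sum)
  also have "\<dots> = (\<Sum>k<m i. pos_part (g i t ?x k) * (g i t ?x k + \<epsilon>))"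
    by (simp add: sum.distrib sum_distrib_right distrib_left pos_part_mult_self mult.commute[of \<epsilon>])
  also have "\<dots> \<le> ?A"
  proof (intro sum_mono mult_left_mono)
    fix k assume k: "k \<in> {..<m i}"
    then have "g i t y k \<ge> g i t ?x k + dg i t ?x k \<bullet> (y - ?x)"
      using subgradient_g[OF t x, of k i] by (simp add: subgradient_def)
    with gy[of k] k show "g i t ?x k + \<epsilon> \<le> dg i t ?x k \<bullet> (?x - y)"
      by (simp add: inner_diff_right)
  qed simp
  finally have "\<gamma> t * (?v\<^sup>2 + \<epsilon> * ?v) \<le> \<gamma> t * ?A"
    using \<gamma> by simp
  moreover have "f i t ?x - f i t y + \<mu> * bregman \<psi> d\<psi> y ?x \<le> df i t ?x \<bullet> (?x - y)"
    using relative_strong_convexity[OF t y x, of i] by (simp add: inner_diff_left inner_diff_right inner_commute)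
  ultimately have "f i t ?x - f i t y + \<mu> * bregman \<psi> d\<psi> y ?x + \<gamma> t * (?v\<^sup>2 + \<epsilon> * ?v) \<le> \<omega> i (t + 1) \<bullet> (?x - y)"
    unfolding inner_\<omega>[OF t] by linarith
  then have "?a * (f i t ?x - f i t y + \<mu> * bregman \<psi> d\<psi> y ?x + \<gamma> t * (?v\<^sup>2 + \<epsilon> * ?v)) + ?a * (r t ?x - r t y)
      \<le> ?a * (\<omega> i (t + 1) \<bullet> (?x - y)) + ?a * (r t ?x - r t y)"
    using a by simp
  \<comment> \<open>Split \<open>x - y\<close> into the displacement \<open>x - z\<close> and the
    part \<open>z - y\<close> controlled by optimality.\<close>
  also have "\<dots> = (?a * (\<omega> i (t + 1) \<bullet> (?x - ?z)) + ?a * (r t ?x - r t ?z))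
      + (?a * ((?z - y) \<bullet> \<omega> i (t + 1)) + ?a * (r t ?z - r t y))"
    by (simp add: inner_diff_left inner_diff_right inner_commute algebra_simps)
  also have "\<dots> \<le> (?a * G1 + \<gamma>0 * G2 * ?v) * norm (?x - ?z)
      + (bregman \<psi> d\<psi> y ?x - bregman \<psi> d\<psi> y ?z - bregman \<psi> d\<psi> ?z ?x)"
    by (intro add_mono forward_step_bound prox_optimality t y z)
  \<comment> \<open>The divergence of \<open>z\<close> from \<open>x\<close> supplies the negative
    quadratic term for Young's inequality.\<close>
  also have "\<dots> \<le> (?a * G1 + \<gamma>0 * G2 * ?v) * norm (?x - ?z) - \<sigma> / 2 * (norm (?x - ?z))\<^sup>2
      + (bregman \<psi> d\<psi> y ?x - bregman \<psi> d\<psi> y ?z)"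
    using bregman_lower[OF z x] by (simp add: norm_minus_commute)
  also have "\<dots> \<le> (?a\<^sup>2 * G1\<^sup>2 / \<sigma> + \<gamma>0 / 4 * ?v\<^sup>2) + (bregman \<psi> d\<psi> y ?x - bregman \<psi> d\<psi> y ?z)"
    using a by (intro add_right_mono young_step) auto
  also have "\<gamma>0 / 4 * ?v\<^sup>2 = ?a * (\<gamma> t / 4 * ?v\<^sup>2)"
    by (simp add: a\<gamma>[symmetric])
  finally have "?a * (loss i t ?x - loss i t y + \<epsilon> * \<gamma> t * ?v + 3 / 4 * \<gamma> t * ?v\<^sup>2)
      \<le> ?a * (?a * G1\<^sup>2 / \<sigma>) + (1 - ?a * \<mu>) * bregman \<psi> d\<psi> y ?x - bregman \<psi> d\<psi> y ?z"
    by (simp add: algebra_simps power2_eq_square)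
  also have "\<dots> = ?a * (?a * G1\<^sup>2 / \<sigma> + (1 / ?a - \<mu>) * bregman \<psi> d\<psi> y ?x - 1 / ?a * bregman \<psi> d\<psi> y ?z)"
    using a by (simp add: field_simps)
  finally show ?thesis
    using a by (simp only: mult_le_cancel_left_pos)
qed

text \<open>Unit row sums allow Jensen's inequality in the second argument; unit column sums restore
  the unweighted sum over agents.\<close>

lemma bregman_averaging:
  assumes t: "t \<ge> 1" and y: "y \<in> X"
  shows "(\<Sum>i\<in>UNIV. bregman \<psi> d\<psi> y (x i t)) \<le> (\<Sum>i\<in>UNIV. bregman \<psi> d\<psi> y (z i t))"
proof -
  have "(\<Sum>i\<in>UNIV. bregman \<psi> d\<psi> y (x i t)) \<le> (\<Sum>i\<in>UNIV. \<Sum>j\<in>UNIV. W t $ i $ j * bregman \<psi> d\<psi> y (z j t))"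
    unfolding x_eq[OF t] using t
    by (intro sum_mono convex_on_sum[OF _ _ bregman_convex[OF y]]) (auto simp: row_sum weight_nonneg z_in)
  also have "\<dots> = (\<Sum>j\<in>UNIV. (\<Sum>i\<in>UNIV. W t $ i $ j) * bregman \<psi> d\<psi> y (z j t))"
    unfolding sum_distrib_right by (rule sum.swap)
  finally show ?thesis
    by (simp add: column_sum[OF t])
qed

text \<open>The coefficients \<open>1 / \<alpha> t - \<mu> = \<mu> * (t - 1)\<close> and \<open>1 / \<alpha> t = \<mu> * t\<close> of the divergences
  telescope, and the initial one vanishes.\<close>

lemma cumulative_bound:
  assumes y: "y \<in> X" and \<epsilon>: "\<epsilon> \<ge> 0"
    and gy: "\<And>t i k. 1 \<le> t \<Longrightarrow> t \<le> T \<Longrightarrow> k < m i \<Longrightarrow> g i t y k \<le> - \<epsilon>"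
  shows "(\<Sum>t=1..T. \<Sum>i\<in>UNIV. loss i t (x i t) - loss i t y)
      + \<epsilon> * \<gamma>0 * \<mu> * (\<Sum>t=1..T. real t * (\<Sum>i\<in>UNIV. own_violation i t))
      + 3 / 4 * \<gamma>0 * \<mu> * (\<Sum>t=1..T. real t * (\<Sum>i\<in>UNIV. (own_violation i t)\<^sup>2))
    \<le> CARD('n) * G1\<^sup>2 / (\<sigma> * \<mu>) * (\<Sum>t=1..T. 1 / real t)"
proof -
  let ?\<Phi> = "\<lambda>t. \<mu> * (real t - 1) * (\<Sum>i\<in>UNIV. bregman \<psi> d\<psi> y (z i t))"
  let ?c = "CARD('n) * G1\<^sup>2 / (\<sigma> * \<mu>)"
  have step: "(\<Sum>i\<in>UNIV. loss i t (x i t) - loss i t y)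
      + \<epsilon> * \<gamma>0 * \<mu> * (real t * (\<Sum>i\<in>UNIV. own_violation i t))
      + 3 / 4 * \<gamma>0 * \<mu> * (real t * (\<Sum>i\<in>UNIV. (own_violation i t)\<^sup>2))
    \<le> ?c * (1 / real t) + (?\<Phi> t - ?\<Phi> (Suc t))" if t: "1 \<le> t" "t \<le> T" for t
  proof -
    have inv: "1 / \<alpha> t = \<mu> * t"
      using t \<mu>_pos by (simp add: \<alpha>_eq)
    have "(\<Sum>i\<in>UNIV. loss i t (x i t) - loss i t y + \<epsilon> * \<gamma> t * own_violation i t
          + 3 / 4 * \<gamma> t * (own_violation i t)\<^sup>2)
        \<le> (\<Sum>i\<in>UNIV. \<alpha> t * G1\<^sup>2 / \<sigma> + (1 / \<alpha> t - \<mu>) * bregman \<psi> d\<psi> y (x i t)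
          - 1 / \<alpha> t * bregman \<psi> d\<psi> y (z i (t + 1)))"
      using t by (intro sum_mono one_step y \<epsilon> gy) auto
    also have "\<dots> = ?c * (1 / real t) + \<mu> * (real t - 1) * (\<Sum>i\<in>UNIV. bregman \<psi> d\<psi> y (x i t)) - ?\<Phi> (Suc t)"
      unfolding inv using t
      by (simp add: \<alpha>_eq sum.distrib sum_subtractf sum_distrib_left right_diff_distrib left_diff_distrib mult.commute)
    also have "\<dots> \<le> ?c * (1 / real t) + ?\<Phi> t - ?\<Phi> (Suc t)"
      using t \<mu>_pos bregman_averaging[OF t(1) y] by (simp add: mult_left_mono)
    finally show ?thesis
      unfolding \<gamma>_eq'[OF t(1)] sum.distrib sum_distrib_left[symmetric] by (simp add: algebra_simps)
  qed
  have "(\<Sum>t=1..T. (\<Sum>i\<in>UNIV. loss i t (x i t) - loss i t y)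
      + \<epsilon> * \<gamma>0 * \<mu> * (real t * (\<Sum>i\<in>UNIV. own_violation i t))
      + 3 / 4 * \<gamma>0 * \<mu> * (real t * (\<Sum>i\<in>UNIV. (own_violation i t)\<^sup>2)))
    \<le> (\<Sum>t=1..T. ?c * (1 / real t) + (?\<Phi> t - ?\<Phi> (Suc t)))"
    by (intro sum_mono step) auto
  also have "\<dots> = ?c * (\<Sum>t=1..T. 1 / real t) - ?\<Phi> (Suc T)"
    using sum_Suc_diff[of 1 T ?\<Phi>]
    by (simp add: sum.distrib sum_distrib_left sum_subtractf)
  also have "\<dots> \<le> ?c * (\<Sum>t=1..T. 1 / real t)"
  proof -
    have "0 \<le> bregman \<psi> d\<psi> y (z i (Suc T))" for i
      using bregman_lower[OF y z_in[of "Suc T" i]] \<sigma>_pos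
      by (smt (verit, best) One_nat_def Suc_le_mono bot_nat_0.extremum half_gt_zero_iff mult_nonneg_nonneg zero_le_power2)
    then show ?thesis
      using \<mu>_pos by (simp add: sum_nonneg)
  qed
  finally show ?thesis
    by (simp only: sum.distrib flip: sum_distrib_left)
qed

lemma consensus_bound:
  defines "\<delta> \<equiv> CARD('n) * w ^ (CARD('n) * B)"
  shows "\<delta> * (\<Sum>t=1..T. diameter (range (\<lambda>i. z i t)))
    \<le> CARD('n) * B * (diameter (range z1) + 4 * (CARD('n) * G1 / (\<mu> * \<sigma>) * (\<Sum>t=1..T. 1 / real t)
        + \<gamma>0 * G2 / \<sigma> * (\<Sum>t=1..T. \<Sum>i\<in>UNIV. own_violation i t)))"
proof -
  \<comment> \<open>The perturbation bound must be the same for all agents; the sum over agents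
    serves as such a bound.\<close>
  let ?\<epsilon> = "\<lambda>t. \<Sum>i\<in>UNIV. (\<alpha> t * G1 + \<gamma>0 * G2 * own_violation i t) / \<sigma>"
  have "\<delta> * (\<Sum>t=1..T. diameter (range (\<lambda>i. z i t)))
      \<le> CARD('n) * B * (diameter (range (\<lambda>i. z i 1)) + 4 * (\<Sum>t=1..T. ?\<epsilon> t))"
    unfolding \<delta>_def
  proof (rule consensus_error_sum[OF B_pos w_pos, where e = "\<lambda>i t. z i (Suc t) - x i t"])
    fix s i assume s: "(1::nat) \<le> s"
    show "z i (Suc s) = (\<Sum>j\<in>UNIV. W s $ i $ j *\<^sub>R z j s) + (z i (Suc s) - x i s)"
      by (simp add: x_eq[OF s])
    have "norm (z i (Suc s) - x i s) \<le> (\<alpha> s * G1 + \<gamma>0 * G2 * own_violation i s) / \<sigma>"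
      using displacement_bound[OF s, of i] by simp
    also have "\<dots> \<le> ?\<epsilon> s"
      using \<alpha>_pos[OF s] G1_pos G2_pos \<gamma>0_pos \<sigma>_pos
      by (intro member_le_sum[where f = "\<lambda>i. (\<alpha> s * G1 + \<gamma>0 * G2 * own_violation i s) / \<sigma>"]) auto
    finally show "norm (z i (Suc s) - x i s) \<le> ?\<epsilon> s" .
  qed
  also have "(\<Sum>t=1..T. ?\<epsilon> t) = (\<Sum>t=1..T. CARD('n) * G1 / (\<mu> * \<sigma>) * (1 / real t)
      + \<gamma>0 * G2 / \<sigma> * (\<Sum>i\<in>UNIV. own_violation i t))"
    by (intro sum.cong) (simp_all add: \<alpha>_eq sum.distrib add_divide_distrib sum_distrib_left sum_divide_distrib mult_ac)
  also have "\<dots> = CARD('n) * G1 / (\<mu> * \<sigma>) * (\<Sum>t=1..T. 1 / real t)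
        + \<gamma>0 * G2 / \<sigma> * (\<Sum>t=1..T. \<Sum>i\<in>UNIV. own_violation i t)"
    by (simp only: sum.distrib sum_distrib_left)
  finally show ?thesis
    by (simp only: z_1)
qed

text \<open>The \<open>x i t\<close> are convex combinations of the \<open>z j t\<close>; this is
  the contraction lemma with \<open>\<delta> = 0\<close>.\<close>

lemma disagreement_bound:
  assumes t: "t \<ge> 1"
  shows "norm (x i t - x j t) \<le> diameter (range (\<lambda>i. z i t))"
proof -
  have "norm (x i t - x j t) \<le> (1 - real CARD('n) * 0) * diameter (range (\<lambda>i. z i t))"
    unfolding x_eq[OF t]
    by (intro dobrushin_contraction row_sum weight_nonneg t)
      (auto intro!: diameter_bounded_bound finite_imp_bounded simp flip: dist_norm)
  then show ?thesis
    by simp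
qed

text \<open>Regret evaluates every loss at every agent's point. Moving the argument of loss
  \<open>j\<close> to \<open>x j t\<close> costs \<open>G1\<close> times the diameter and leaves the
  sum that the mirror step controls.\<close>

lemma net_regret_le:
  assumes T: "T \<ge> 1"
  obtains y where "y \<in> feasible_set X m g T"
    "CARD('n) * net_regret X m loss g x T
      \<le> (\<Sum>t=1..T. \<Sum>i\<in>UNIV. loss i t (x i t) - loss i t y)
        + CARD('n) * G1 * (\<Sum>t=1..T. diameter (range (\<lambda>i. z i t)))"
proof -
  let ?D = "\<lambda>t. diameter (range (\<lambda>i. z i t))"
  obtain y where y: "y \<in> feasible_set X m g T"
    "(LEAST v. v \<in> (\<lambda>y. \<Sum>t=1..T. avg_loss loss t y) ` feasible_set X m g T) = (\<Sum>t=1..T. avg_loss loss t y)"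
    by (rule regret_minimum_attained[OF T bounded_X])
  have "CARD('n) * net_regret X m loss g x T = (\<Sum>i\<in>UNIV. \<Sum>t=1..T. avg_loss loss t (x i t) - avg_loss loss t y)"
    unfolding net_regret_def y(2) by (simp add: sum_subtractf)
  also have "\<dots> = (\<Sum>t=1..T. \<Sum>i\<in>UNIV. avg_loss loss t (x i t) - avg_loss loss t y)"
    by (rule sum.swap)
  also have "\<dots> \<le> (\<Sum>t=1..T. (\<Sum>i\<in>UNIV. loss i t (x i t) - loss i t y) + CARD('n) * G1 * ?D t)"
  proof (rule sum_mono)
    fix t assume "t \<in> {1..T}"
    then have t: "t \<ge> 1"
      by simp
    have "loss j t (x i t) \<le> loss j t (x j t) + G1 * ?D t" for i j
    proof -
      have "loss j t (x i t) - loss j t (x j t) \<le> G1 * norm (x i t - x j t)"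
        by (rule loss_lipschitz[OF t x_in[OF t]])
      also have "\<dots> \<le> G1 * ?D t"
        using disagreement_bound[OF t] G1_pos by simp
      finally show ?thesis
        by simp
    qed
    then have "(\<Sum>j\<in>UNIV. loss j t (x i t)) \<le> (\<Sum>j\<in>UNIV. loss j t (x j t) + G1 * ?D t)" for i
      by (rule sum_mono)
    then have "(\<Sum>j\<in>UNIV. loss j t (x i t) - loss j t y)
        \<le> (\<Sum>j\<in>UNIV. loss j t (x j t) - loss j t y) + CARD('n) * G1 * ?D t" for i
      unfolding sum_subtractf by (simp add: sum.distrib[of _ "\<lambda>_. G1 * ?D t"] mult.assoc)
    then have "avg_loss loss t (x i t) - avg_loss loss t y
        \<le> ((\<Sum>j\<in>UNIV. loss j t (x j t) - loss j t y) + CARD('n) * G1 * ?D t) / CARD('n)" for i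
      unfolding avg_loss_def diff_divide_distrib[symmetric] sum_subtractf[symmetric]
      by (rule divide_right_mono) simp
    then have "(\<Sum>i\<in>UNIV. avg_loss loss t (x i t) - avg_loss loss t y)
        \<le> (\<Sum>i\<in>(UNIV::'n set). ((\<Sum>j\<in>UNIV. loss j t (x j t) - loss j t y) + CARD('n) * G1 * ?D t) / CARD('n))"
      by (rule sum_mono)
    then show "(\<Sum>i\<in>UNIV. avg_loss loss t (x i t) - avg_loss loss t y)
        \<le> (\<Sum>i\<in>UNIV. loss i t (x i t) - loss i t y) + CARD('n) * G1 * ?D t"
      by simp
  qed
  also have "\<dots> = (\<Sum>t=1..T. \<Sum>i\<in>UNIV. loss i t (x i t) - loss i t y) + CARD('n) * G1 * (\<Sum>t=1..T. ?D t)"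
    by (simp only: sum.distrib sum_distrib_left)
  finally show ?thesis
    by (rule that[OF y(1)])
qed

lemma net_violation_le:
  "net_violation m g x T \<le> (\<Sum>t=1..T. \<Sum>i\<in>UNIV. own_violation i t)
    + CARD('n) * G2 * (\<Sum>t=1..T. diameter (range (\<lambda>i. z i t)))"
proof -
  let ?D = "\<lambda>t. diameter (range (\<lambda>i. z i t))"
  let ?N = "\<lambda>i t. L2_set (\<lambda>(j, k). pos_part (g j t (x i t) k)) (SIGMA j:UNIV. {..<m j})"
  have "(\<Sum>t=1..T. ?N i t) \<le> (\<Sum>t=1..T. (\<Sum>j\<in>UNIV. own_violation j t) + CARD('n) * G2 * ?D t)" for i
  proof (rule sum_mono)
    fix t assume "t \<in> {1..T}"
    then have t: "t \<ge> 1"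
      by simp
    have "?N i t \<le> (\<Sum>j\<in>UNIV. violation (m j) (g j t (x i t)))"
      by (rule stacked_violation_le)
    also have "\<dots> \<le> (\<Sum>j\<in>UNIV. own_violation j t + G2 * ?D t)"
    proof (rule sum_mono)
      fix j
      have "violation (m j) (g j t (x i t)) \<le> own_violation j t + G2 * norm (x i t - x j t)"
        by (rule violation_lipschitz[OF t x_in[OF t]])
      also have "\<dots> \<le> own_violation j t + G2 * ?D t"
        using disagreement_bound[OF t] G2_pos by simp
      finally show "violation (m j) (g j t (x i t)) \<le> own_violation j t + G2 * ?D t" .
    qed
    finally show "?N i t \<le> (\<Sum>j\<in>UNIV. own_violation j t) + CARD('n) * G2 * ?D t"
      by (simp add: sum.distrib)
  qed
  then have "net_violation m g x T
      \<le> (\<Sum>i\<in>(UNIV::'n set). \<Sum>t=1..T. (\<Sum>j\<in>UNIV. own_violation j t) + CARD('n) * G2 * ?D t) / CARD('n)"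
    unfolding net_violation_def by (intro divide_right_mono sum_mono[of UNIV]) auto
  also have "\<dots> = (\<Sum>t=1..T. (\<Sum>j\<in>UNIV. own_violation j t) + CARD('n) * G2 * ?D t)"
    by simp
  finally show ?thesis
    by (simp only: sum.distrib sum_distrib_left)
qed

end

subsection \<open>Rates\<close>

text \<open>The difference \<open>harm T - ln T\<close> is decreasing; for \<open>T \<ge> 2\<close>
  the additive constant is absorbed through \<open>ln 2 \<le> ln T\<close>.\<close>

lemma harmonic_le_ln:
  assumes "T \<ge> 2"
  shows "(\<Sum>t=1..T. 1 / real t) \<le> (1 + 1 / ln 2) * ln (real T)"
proof -
  have "harm T - ln (real T) \<le> harm 1 - ln (real 1)"
    using assms euler_mascheroni_sequence_decreasing[of 1 T] by simp
  then have "(\<Sum>t=1..T. 1 / real t) \<le> 1 + ln (real T)"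
    by (simp add: harm_def inverse_eq_divide)
  also have "1 \<le> 1 / ln 2 * ln (real T)"
    using assms by (simp add: field_simps)
  finally show ?thesis
    by (simp add: algebra_simps)
qed

lemma affine_harmonic_le_ln:
  assumes "T \<ge> 2" "a \<ge> 0" "b \<ge> 0"
  shows "a + b * (\<Sum>t=1..T. 1 / real t) \<le> (a / ln 2 + b * (1 + 1 / ln 2)) * ln (real T)"
proof -
  have "a * ln 2 \<le> a * ln (real T)"
    using assms by (intro mult_left_mono) auto
  then have "a \<le> a / ln 2 * ln (real T)"
    by (simp add: field_simps)
  moreover have "b * (\<Sum>t=1..T. 1 / real t) \<le> b * ((1 + 1 / ln 2) * ln (real T))"
    using assms by (intro mult_left_mono harmonic_le_ln)
  ultimately show ?thesis
    by (simp add: distrib_right mult.assoc)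
qed

text \<open>Cauchy-Schwarz over pairs of round and agent, with factors \<open>1 / sqrt t\<close> and
  \<open>sqrt t * v i t\<close>.\<close>

lemma weighted_sum_power2_le:
  fixes v :: "'n::finite \<Rightarrow> nat \<Rightarrow> real"
  shows "(\<Sum>t=1..T. \<Sum>i\<in>UNIV. v i t)\<^sup>2
    \<le> CARD('n) * (\<Sum>t=1..T. 1 / real t) * (\<Sum>t=1..T. real t * (\<Sum>i\<in>UNIV. (v i t)\<^sup>2))"
proof -
  let ?A = "{1..T} \<times> (UNIV :: 'n set)"
  let ?a = "\<lambda>p::nat \<times> 'n. 1 / sqrt (real (fst p))"
  let ?b = "\<lambda>p::nat \<times> 'n. sqrt (real (fst p)) * v (snd p) (fst p)"
  have "(\<Sum>t=1..T. \<Sum>i\<in>UNIV. v i t) = (\<Sum>p\<in>?A. ?a p * ?b p)"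
    unfolding sum.cartesian_product by (intro sum.cong) auto
  then have "(\<Sum>t=1..T. \<Sum>i\<in>UNIV. v i t)\<^sup>2 \<le> (\<Sum>p\<in>?A. (?a p)\<^sup>2) * (\<Sum>p\<in>?A. (?b p)\<^sup>2)"
    by (simp only: Cauchy_Schwarz_ineq_sum)
  also have "(\<Sum>p\<in>?A. (?a p)\<^sup>2) = (\<Sum>t=1..T. \<Sum>i\<in>(UNIV::'n set). 1 / real t)"
    unfolding sum.cartesian_product by (intro sum.cong) (auto simp: power_divide)
  also have "\<dots> = CARD('n) * (\<Sum>t=1..T. 1 / real t)"
    by (simp add: sum_distrib_left)
  also have "(\<Sum>p\<in>?A. (?b p)\<^sup>2) = (\<Sum>t=1..T. real t * (\<Sum>i\<in>UNIV. (v i t)\<^sup>2))"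
    unfolding sum_distrib_left sum.cartesian_product by (intro sum.cong) (auto simp: power_mult_distrib)
  finally show ?thesis .
qed

text \<open>Summation by parts: with \<open>U\<close> the weighted partial sum, passing from
  \<open>T\<close> to \<open>T + 1\<close> leaves a remainder
  \<open>U / (T * (T + 1)) \<le> C / (T + 1)\<close>.\<close>

lemma sum_le_harmonic_of_weighted_sum:
  fixes h :: "nat \<Rightarrow> real"
  assumes U: "\<And>T. T \<ge> 1 \<Longrightarrow> (\<Sum>t=1..T. real t * h t) \<le> C * real T" and T: "T \<ge> 1"
  shows "(\<Sum>t=1..T. h t) \<le> C * (\<Sum>t=1..T. 1 / real t)"
proof -
  have "(\<Sum>t=1..T. h t) \<le> (\<Sum>t=1..T. real t * h t) / T + C * ((\<Sum>t=1..T. 1 / real t) - 1)"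
    using T
  proof (induction T rule: dec_induct)
    case (step T)
    let ?U = "\<Sum>t=1..T. real t * h t"
    have T: "real T > 0"
      using step by simp
    have "?U / T - ?U / Suc T = ?U / (real T * Suc T)"
      using T by (simp add: field_simps)
    also have "\<dots> \<le> C * real T / (real T * Suc T)"
      using U[OF step(1)] by (intro divide_right_mono) auto
    finally have "?U / T - ?U / Suc T \<le> C / Suc T"
      using T by simp
    moreover have "(\<Sum>t=1..Suc T. real t * h t) / Suc T = ?U / Suc T + h (Suc T)"
      by (simp add: add_divide_distrib)
    moreover have "C * ((\<Sum>t=1..Suc T. 1 / real t) - 1) = C * ((\<Sum>t=1..T. 1 / real t) - 1) + C / Suc T"
      by (simp add: algebra_simps)
    ultimately show ?case
      using step.IH by simp
  qed simp
  also have "(\<Sum>t=1..T. real t * h t) / T \<le> C"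
    using U[OF T] T by (simp add: field_simps)
  finally show ?thesis
    by (simp add: algebra_simps)
qed

text \<open>The arithmetic-geometric mean inequality, with \<kappa> chosen so that the quadratic
  term \<open>Q\<close> pays for the linear term \<open>V\<close>.\<close>

lemma mult_le_of_power2_le:
  fixes V Q a \<kappa> M :: real
  assumes "V\<^sup>2 \<le> a * Q" "a \<ge> 0" "Q \<ge> 0" "\<kappa> > 0"
  shows "M * V \<le> \<kappa> * Q + M\<^sup>2 * a / (4 * \<kappa>)"
proof (rule power2_le_imp_le)
  have "(M * V)\<^sup>2 \<le> M\<^sup>2 * (a * Q)"
    using assms(1) by (simp add: power_mult_distrib mult_left_mono)
  also have "\<dots> = 4 * (\<kappa> * Q) * (M\<^sup>2 * a / (4 * \<kappa>))"
    using assms(4) by (simp add: field_simps)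
  also have "\<dots> \<le> (\<kappa> * Q + M\<^sup>2 * a / (4 * \<kappa>))\<^sup>2"
  proof -
    have "4 * p * r \<le> (p + r)\<^sup>2" for p r :: real
      using sum_squares_bound[of p r] by (simp add: power2_sum)
    then show ?thesis .
  qed
  finally show "(M * V)\<^sup>2 \<le> (\<kappa> * Q + M\<^sup>2 * a / (4 * \<kappa>))\<^sup>2" .
qed (use assms in simp)

section \<open>Weighted violation sums\<close>

context mirror_descent
begin

lemma cumulative_loss_lower:
  assumes y: "y \<in> X"
  shows "- (CARD('n) * F * T) \<le> (\<Sum>t=1..T. \<Sum>i\<in>UNIV. loss i t (x i t) - loss i t y)"
proof -
  have "(\<Sum>t=1..T. \<Sum>i\<in>(UNIV::'n set). - F) \<le> (\<Sum>t=1..T. \<Sum>i\<in>UNIV. loss i t (x i t) - loss i t y)"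
    using y by (intro sum_mono) (smt (verit) atLeastAtMost_iff loss_variation x_in)
  then show ?thesis
    by (simp add: mult_ac)
qed

text \<open>The loss difference can be negative, but not below a multiple of \<open>T\<close>;
  estimating the harmonic sum by \<open>T\<close> gives a linear bound. It is used with
  \<open>\<epsilon> = 0\<close> for feasible comparators and with positive \<epsilon> under Slater's
  condition.\<close>

lemma weighted_violation_bound:
  assumes y: "y \<in> X" and \<epsilon>: "\<epsilon> \<ge> 0"
    and gy: "\<And>t i k. 1 \<le> t \<Longrightarrow> t \<le> T \<Longrightarrow> k < m i \<Longrightarrow> g i t y k \<le> - \<epsilon>"
  shows "\<epsilon> * \<gamma>0 * \<mu> * (\<Sum>t=1..T. real t * (\<Sum>i\<in>UNIV. own_violation i t))
      + 3 / 4 * \<gamma>0 * \<mu> * (\<Sum>t=1..T. real t * (\<Sum>i\<in>UNIV. (own_violation i t)\<^sup>2))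
    \<le> (CARD('n) * G1\<^sup>2 / (\<sigma> * \<mu>) + CARD('n) * F) * T"
proof -
  let ?c = "CARD('n) * G1\<^sup>2 / (\<sigma> * \<mu>)"
  have "(\<Sum>t=1..T. 1 / real t) \<le> (\<Sum>t=1..T. 1)"
    by (intro sum_mono) auto
  then have "?c * (\<Sum>t=1..T. 1 / real t) \<le> ?c * T"
    using \<sigma>_pos \<mu>_pos by (intro mult_left_mono) auto
  moreover have "(\<Sum>t=1..T. \<Sum>i\<in>UNIV. loss i t (x i t) - loss i t y)
      + \<epsilon> * \<gamma>0 * \<mu> * (\<Sum>t=1..T. real t * (\<Sum>i\<in>UNIV. own_violation i t))
      + 3 / 4 * \<gamma>0 * \<mu> * (\<Sum>t=1..T. real t * (\<Sum>i\<in>UNIV. (own_violation i t)\<^sup>2))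
    \<le> ?c * (\<Sum>t=1..T. 1 / real t)"
    by (rule cumulative_bound[OF y \<epsilon>]) (rule gy)
  ultimately show ?thesis
    using cumulative_loss_lower[OF y, of T] unfolding distrib_right by linarith
qed

end

text \<open>The constants are chosen before the problem data, the network and the run, so they are
  uniform over all of these. Under Slater's condition the constant may also depend on the
  margin.\<close>

theorem theorem4:
  fixes F G1 G2 w \<sigma> \<mu> \<gamma>0 :: real
    and B :: nat
    and m :: "'n::finite \<Rightarrow> nat"
    and z1 :: "'n \<Rightarrow> real ^ 'p"
  assumes "F > 0" and "G1 > 0" and "G2 > 0"
    and "0 < w" and "w < 1" and "B > 0"
    and "\<sigma> > 0" and "\<mu> > 0"
    and "0 < \<gamma>0" and "\<gamma>0 \<le> \<sigma> / (4 * G2\<^sup>2)"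
  shows "\<exists>C>0. \<exists>C_slater :: real \<Rightarrow> real. (\<forall>\<epsilon>>0. C_slater \<epsilon> > 0) \<and>
    (\<forall>X \<psi> d\<psi> f r g df dg E W \<alpha> \<gamma> x z q \<omega>.
       online_problem X m f r g df dg F G1 G2 \<and>
       mixing_network E W w B \<and>
       mirror_map X \<psi> d\<psi> \<sigma> \<and>
       (\<forall>i. \<forall>t\<ge>1. \<forall>x\<in>X. \<forall>y\<in>X.
          f i t x \<ge> f i t y + (x - y) \<bullet> df i t y + \<mu> * bregman \<psi> d\<psi> x y) \<and>
       (\<forall>t\<ge>1. \<alpha> t = 1 / (\<mu> * real t)) \<and>
       (\<forall>t\<ge>1. \<gamma> t = \<gamma>0 / \<alpha> t) \<and>
       mirror_descent_run X \<psi> d\<psi> m r g df dg W \<alpha> \<gamma> z1 x z q \<omega>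
       \<longrightarrow>
       (\<forall>T\<ge>2. net_regret X m (\<lambda>i t y. f i t y + r t y) g x T \<le> C * ln (real T)) \<and>
       (\<forall>T\<ge>2. net_violation m g x T \<le> C * sqrt (ln (real T) * real T)) \<and>
       (\<forall>xs\<in>X. \<forall>\<epsilon>>0. slater m g xs \<epsilon> \<longrightarrow>
          (\<forall>T\<ge>2. net_violation m g x T \<le> C_slater \<epsilon> * ln (real T))))"
proof -
  \<comment> \<open>Here \<open>s0\<close>, \<open>s1\<close>, \<open>s2\<close> are the
    coefficients of 1, the harmonic sum and the total violation in the disagreement bound;
    \<open>c\<close> and \<kappa> come from the cumulative bound, \<open>M\<close> weighs the total
    violation in the regret, and \<open>h\<close> converts harmonic sums into logarithms.\<close>
  define n where "n = real CARD('n)"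
  define \<delta> where "\<delta> = n * w ^ (CARD('n) * B)"
  define K where "K = real (CARD('n) * B) / \<delta>"
  define s0 where "s0 = K * diameter (range z1)"
  define s1 where "s1 = K * (4 * (n * G1 / (\<mu> * \<sigma>)))"
  define s2 where "s2 = K * (4 * (\<gamma>0 * G2 / \<sigma>))"
  define c where "c = n * G1\<^sup>2 / (\<sigma> * \<mu>)"
  define \<kappa> where "\<kappa> = 3 / 4 * \<gamma>0 * \<mu>"
  define M where "M = n * G1 * s2"
  define h where "h = 1 + 1 / ln (2::real)"
  define C_reg where "C_reg = n * G1 * s0 / ln 2 + (c + n * G1 * s1 + M\<^sup>2 * n / (4 * \<kappa>)) * h"
  define C_viol where "C_viol = n * G2 * s0 / ln 2 + n * G2 * s1 * h + (1 + n * G2 * s2) * sqrt (n * h * ((c + n * F) / \<kappa>))"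
  define C_slater where "C_slater = (\<lambda>\<epsilon>. n * G2 * s0 / ln 2
      + (n * G2 * s1 + (1 + n * G2 * s2) * ((c + n * F) / (\<epsilon> * \<gamma>0 * \<mu>))) * h)"
  have n: "n \<ge> 1"
    unfolding n_def by (simp add: Suc_le_eq)
  have \<delta>: "\<delta> > 0"
    using n assms by (simp add: \<delta>_def)
  have K: "K > 0"
    using \<delta> assms unfolding K_def by simp
  have s0: "s0 \<ge> 0"
    using K diameter_ge_0[of "range z1"] by (simp add: s0_def finite_imp_bounded)
  have pos: "s1 > 0" "s2 > 0" "c > 0" "\<kappa> > 0" "h > 0"
    using n K assms by (simp_all add: s1_def s2_def c_def \<kappa>_def h_def add_pos_pos)
  have C_reg: "C_reg > 0" and C_viol: "C_viol > 0"
    unfolding C_reg_def C_viol_def using n s0 pos assms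
    by (intro add_nonneg_pos mult_pos_pos add_pos_pos add_pos_nonneg; simp)+
  have C_slater: "C_slater \<epsilon> > 0" if "\<epsilon> > 0" for \<epsilon>
    unfolding C_slater_def using n s0 pos assms that
    by (intro add_nonneg_pos mult_pos_pos divide_pos_pos add_pos_pos; simp)
  have bounds: "(\<forall>T\<ge>2. net_regret X m (\<lambda>i t y. f i t y + r t y) g x T \<le> C_reg * ln (real T)) \<and>
      (\<forall>T\<ge>2. net_violation m g x T \<le> C_viol * sqrt (ln (real T) * real T)) \<and>
      (\<forall>xs\<in>X. \<forall>\<epsilon>>0. slater m g xs \<epsilon> \<longrightarrow> (\<forall>T\<ge>2. net_violation m g x T \<le> C_slater \<epsilon> * ln (real T)))"
    if run: "mirror_descent X m f r g df dg F G1 G2 E W w B \<psi> d\<psi> \<sigma> \<mu> \<gamma>0 \<alpha> \<gamma> z1 x z q \<omega>"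
    for X :: "(real ^ 'p) set" and f r g df dg E W \<psi> d\<psi> \<alpha> \<gamma> x z q \<omega>
  proof -
    interpret mirror_descent X m f r g df dg F G1 G2 E W w B \<psi> d\<psi> \<sigma> \<mu> \<gamma>0 \<alpha> \<gamma> z1 x z q \<omega>
      by (rule run)
    let ?H = "\<lambda>T. \<Sum>t=1..T. 1 / real t"
    let ?V = "\<lambda>T. \<Sum>t=1..T. \<Sum>i\<in>UNIV. own_violation i t"
    let ?Q = "\<lambda>T. \<Sum>t=1..T. real t * (\<Sum>i\<in>UNIV. (own_violation i t)\<^sup>2)"
    let ?S = "\<lambda>T. \<Sum>t=1..T. diameter (range (\<lambda>i. z i t))"
    have H0: "?H T \<ge> 0" and V0: "?V T \<ge> 0" and Q0: "?Q T \<ge> 0" for T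
      by (auto intro!: sum_nonneg mult_nonneg_nonneg)
    have VQ: "(?V T)\<^sup>2 \<le> n * ?H T * ?Q T" for T
      using weighted_sum_power2_le[of own_violation T] by (simp only: n_def)
    have S: "?S T \<le> s0 + s1 * ?H T + s2 * ?V T" for T
    proof -
      have "\<delta> * ?S T \<le> real (CARD('n) * B) * (diameter (range z1)
          + 4 * (n * G1 / (\<mu> * \<sigma>) * ?H T + \<gamma>0 * G2 / \<sigma> * ?V T))"
        using consensus_bound[of T] unfolding \<delta>_def n_def .
      also have "\<dots> = \<delta> * (s0 + s1 * ?H T + s2 * ?V T)"
        using \<delta> by (simp add: s0_def s1_def s2_def K_def distrib_left)
      finally show ?thesis
        using \<delta> by simp
    qed
    have viol: "net_violation m g x T \<le> n * G2 * s0 + n * G2 * s1 * ?H T + (1 + n * G2 * s2) * ?V T" for T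
    proof -
      have "net_violation m g x T \<le> ?V T + n * G2 * ?S T"
        using net_violation_le[of T] by (simp only: n_def)
      also have "n * G2 * ?S T \<le> n * G2 * (s0 + s1 * ?H T + s2 * ?V T)"
        using S n assms by (intro mult_left_mono) auto
      finally show ?thesis
        by (simp add: algebra_simps)
    qed
    have "net_regret X m loss g x T \<le> C_reg * ln (real T)" if T: "T \<ge> 2" for T
    proof -
      have T1: "T \<ge> 1"
        using T by simp
      obtain y where y: "y \<in> feasible_set X m g T" and
        reg: "n * net_regret X m loss g x T
          \<le> (\<Sum>t=1..T. \<Sum>i\<in>UNIV. loss i t (x i t) - loss i t y) + n * G1 * ?S T"
        using net_regret_le[OF T1] unfolding n_def by blast
      have "(\<Sum>t=1..T. \<Sum>i\<in>UNIV. loss i t (x i t) - loss i t y) + \<kappa> * ?Q T \<le> c * ?H T"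
        using cumulative_bound[of y 0 T] y by (simp add: feasible_set_def c_def \<kappa>_def n_def)
      moreover have "n * G1 * ?S T \<le> n * G1 * (s0 + s1 * ?H T + s2 * ?V T)"
        using S n assms by (intro mult_left_mono) auto
      \<comment> \<open>The quadratic term cancels the violation part of the disagreement, at the
        price of a multiple of the harmonic sum.\<close>
      moreover have "M * ?V T \<le> \<kappa> * ?Q T + M\<^sup>2 * (n * ?H T) / (4 * \<kappa>)"
        using VQ H0 Q0 pos n by (intro mult_le_of_power2_le) auto
      ultimately have "n * net_regret X m loss g x T
          \<le> n * G1 * s0 + (c + n * G1 * s1 + M\<^sup>2 * n / (4 * \<kappa>)) * ?H T"
        using reg by (simp add: M_def algebra_simps)
      also have "\<dots> \<le> C_reg * ln (real T)"
        unfolding C_reg_def h_def using T n s0 pos assms by (intro affine_harmonic_le_ln) auto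
      finally have *: "n * net_regret X m loss g x T \<le> C_reg * ln (real T)" .
      have "0 \<le> C_reg * ln (real T)"
        using C_reg T by simp
      then have "C_reg * ln (real T) \<le> n * (C_reg * ln (real T))"
        using n mult_right_mono[of 1 n "C_reg * ln (real T)"] by simp
      with * have "n * net_regret X m loss g x T \<le> n * (C_reg * ln (real T))"
        by linarith
      with n show ?thesis
        by simp
    qed
    moreover have "net_violation m g x T \<le> C_viol * sqrt (ln (real T) * real T)" if T: "T \<ge> 2" for T
    proof -
      let ?r = "sqrt (ln (real T) * real T)"
      have T1: "T \<ge> 1"
        using T by simp
      obtain y where y: "y \<in> feasible_set X m g T"
        using feasible[OF T1] by blast
      have ln0: "ln (real T) \<ge> 0"
        using T by simp
      \<comment> \<open>Logarithmic terms are absorbed by the square root, since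
        \<open>ln T \<le> sqrt (ln T * T)\<close>.\<close>
      have "ln (real T) \<le> real T"
        using ln_bound[of "real T"] T by simp
      then have "(ln (real T))\<^sup>2 \<le> ln (real T) * real T"
        using ln0 by (simp add: power2_eq_square mult_left_mono)
      then have ln_r: "ln (real T) \<le> ?r"
        by (rule real_le_rsqrt)
      have "\<kappa> * ?Q T \<le> (c + n * F) * T"
        using weighted_violation_bound[of y 0 T] y
        by (simp add: feasible_set_def c_def \<kappa>_def n_def)
      then have Q: "?Q T \<le> (c + n * F) / \<kappa> * T"
        using pos by (simp add: field_simps)
      have "(?V T)\<^sup>2 \<le> n * ?H T * ?Q T"
        by (rule VQ)
      also have "\<dots> \<le> n * (h * ln (real T)) * ((c + n * F) / \<kappa> * T)"
        using harmonic_le_ln[OF T] Q H0 Q0 n ln0 pos unfolding h_def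
        by (intro mult_mono mult_left_mono) auto
      also have "\<dots> = n * h * ((c + n * F) / \<kappa>) * (ln (real T) * real T)"
        by simp
      finally have "?V T \<le> sqrt (n * h * ((c + n * F) / \<kappa>)) * ?r"
        unfolding real_sqrt_mult[symmetric] by (rule real_le_rsqrt)
      then have "(1 + n * G2 * s2) * ?V T \<le> (1 + n * G2 * s2) * (sqrt (n * h * ((c + n * F) / \<kappa>)) * ?r)"
        using n pos assms by (intro mult_left_mono) auto
      moreover have "n * G2 * s0 + n * G2 * s1 * ?H T \<le> (n * G2 * s0 / ln 2 + n * G2 * s1 * h) * ln (real T)"
        unfolding h_def using T n s0 pos assms by (intro affine_harmonic_le_ln) auto
      moreover have "\<dots> \<le> (n * G2 * s0 / ln 2 + n * G2 * s1 * h) * ?r"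
        using ln_r n s0 pos assms by (intro mult_left_mono) auto
      moreover note viol[of T]
      ultimately show ?thesis
        unfolding C_viol_def by (simp only: distrib_right mult.assoc)
    qed
    moreover have "net_violation m g x T \<le> C_slater \<epsilon> * ln (real T)"
      if xs: "xs \<in> X" and \<epsilon>: "\<epsilon> > 0" and sl: "slater m g xs \<epsilon>" and T: "T \<ge> 2" for xs \<epsilon> T
    proof -
      \<comment> \<open>Summation by parts uses the linear bound at every horizon, so it is proved
        for arbitrary \<open>T'\<close>.\<close>
      have "(\<Sum>t=1..T'. real t * (\<Sum>i\<in>UNIV. own_violation i t)) \<le> (c + n * F) / (\<epsilon> * \<gamma>0 * \<mu>) * real T'"
        if T': "T' \<ge> 1" for T'
      proof -
        have "\<epsilon> * \<gamma>0 * \<mu> * (\<Sum>t=1..T'. real t * (\<Sum>i\<in>UNIV. own_violation i t)) + \<kappa> * ?Q T' \<le> (c + n * F) * T'"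
          unfolding c_def \<kappa>_def n_def using xs \<epsilon> sl assms T'
          by (intro weighted_violation_bound[of xs \<epsilon> T']) (auto simp: slater_def)
        moreover have "0 \<le> \<kappa> * ?Q T'"
          using Q0 pos by simp
        ultimately have "\<epsilon> * \<gamma>0 * \<mu> * (\<Sum>t=1..T'. real t * (\<Sum>i\<in>UNIV. own_violation i t)) \<le> (c + n * F) * T'"
          by linarith
        then show ?thesis
          using \<epsilon> assms by (simp add: pos_le_divide_eq mult.commute)
      qed
      then have "?V T \<le> (c + n * F) / (\<epsilon> * \<gamma>0 * \<mu>) * ?H T"
        using T by (intro sum_le_harmonic_of_weighted_sum) auto
      then have "(1 + n * G2 * s2) * ?V T \<le> (1 + n * G2 * s2) * ((c + n * F) / (\<epsilon> * \<gamma>0 * \<mu>) * ?H T)"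
        using n pos assms by (intro mult_left_mono) auto
      with viol[of T] have "net_violation m g x T \<le> n * G2 * s0
          + (n * G2 * s1 + (1 + n * G2 * s2) * ((c + n * F) / (\<epsilon> * \<gamma>0 * \<mu>))) * ?H T"
        by (simp only: distrib_right mult.assoc)
      also have "\<dots> \<le> C_slater \<epsilon> * ln (real T)"
        unfolding C_slater_def h_def using T n s0 pos assms \<epsilon> by (intro affine_harmonic_le_ln) auto
      finally show ?thesis .
    qed
    ultimately show ?thesis
      by blast
  qed
  show ?thesis
  proof (intro exI[of _ "C_reg + C_viol"] conjI exI[of _ C_slater] allI impI; (elim conjE)?)
    show "0 < C_reg + C_viol"
      using C_reg C_viol by simp
    show "\<And>\<epsilon>. 0 < \<epsilon> \<Longrightarrow> 0 < C_slater \<epsilon>"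
      by (rule C_slater)
  next
    fix X :: "(real ^ 'p) set" and \<psi> d\<psi> f r g df dg E W \<alpha> \<gamma> x z q \<omega>
    assume "online_problem X m f r g df dg F G1 G2" "mixing_network E W w B" "mirror_map X \<psi> d\<psi> \<sigma>"
      "\<forall>i. \<forall>t\<ge>1. \<forall>x\<in>X. \<forall>y\<in>X. f i t x \<ge> f i t y + (x - y) \<bullet> df i t y + \<mu> * bregman \<psi> d\<psi> x y"
      "\<forall>t\<ge>1. \<alpha> t = 1 / (\<mu> * real t)" "\<forall>t\<ge>1. \<gamma> t = \<gamma>0 / \<alpha> t"
      "mirror_descent_run X \<psi> d\<psi> m r g df dg W \<alpha> \<gamma> z1 x z q \<omega>"
    then have "mirror_descent X m f r g df dg F G1 G2 E W w B \<psi> d\<psi> \<sigma> \<mu> \<gamma>0 \<alpha> \<gamma> z1 x z q \<omega>"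
      using assms by (intro mirror_descent.intro mirror_descent_axioms.intro) blast+
    note b = bounds[OF this, THEN conjunct1] bounds[OF this, THEN conjunct2, THEN conjunct1]
      bounds[OF this, THEN conjunct2, THEN conjunct2]
    have mono: "C_reg * u \<le> (C_reg + C_viol) * u" "C_viol * u \<le> (C_reg + C_viol) * u" if "u \<ge> 0" for u
      using that C_reg C_viol by (simp_all add: distrib_right)
    show "net_regret X m (\<lambda>i t y. f i t y + r t y) g x T \<le> (C_reg + C_viol) * ln (real T)" if "2 \<le> T" for T
      by (rule order_trans[OF b(1)[rule_format, OF that] mono(1)]) (use that in simp)
    show "net_violation m g x T \<le> (C_reg + C_viol) * sqrt (ln (real T) * real T)" if "2 \<le> T" for T
      by (rule order_trans[OF b(2)[rule_format, OF that] mono(2)]) (use that in simp)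
    show "\<forall>xs\<in>X. \<forall>\<epsilon>>0. slater m g xs \<epsilon> \<longrightarrow> (\<forall>T\<ge>2. net_violation m g x T \<le> C_slater \<epsilon> * ln (real T))"
      by (rule b(3))
  qed
qed

end
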